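(* There is a polynomial-time algorithm that, given a weighted house allocation instance $\langle N,H,V\rangle$, finds an envy-free allocation of maximum egalitarian welfare, should one exist; that is, it returns an allocation that is both envy-free and egalitarian welfare maximizing (among all allocations) if such an allocation exists, and otherwise reports that none exists.
   Context: A house allocation instance $\langle N,H,V\rangle$ consists of a finite set $N$ of $n$ agents, a finite set $H$ of $m$ houses, and for each agent $i\in N$ a valuation $v_i:H\to\mathbb{R}_{\ge 0}$, with the convention $v_i(\emptyset)=0$. A weighted instance allows arbitrary non-negative values. An allocation $A$ assigns to each agent $i$ either one house $A(i)\in H$ or nothing ($A(i)=\emptyset$), with each house assigned to at most one agent; an agent may be assigned a house it values at zero, and houses may remain unassigned. An allocation $A$ is envy-free if $v_i(A(i))\ge v_i(A(j))$ for all $i,j\in N$. Egalitarian welfare maximization: if some allocation gives every agent positive value, an allocation is egalitarian welfare maximizing if it maximizes $\min_{i\in N}v_i(A(i))$. Otherwise, let $k$ be the largest number of agents that can simultaneously receive a positive value in an allocation; an allocation $A$ is egalitarian welfare maximizing if it maximizes the $k$-egalitarian welfare, i.e. the value $\min_{i\in S}v_i(A(i))$ over allocations $A$ and sets $S\subseteq N$ with $|S|=k$. (Equivalently: first maximize the number $k$ of agents receiving positive value, then the minimum value among those $k$ agents.) *)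

theory Defs
  imports Complex_Main "HOL-Computational_Algebra.Polynomial"
begin

section \<open>House allocation\<close>

definition house_instance :: "'a set \<Rightarrow> 'h set \<Rightarrow> ('a \<Rightarrow> 'h \<Rightarrow> real) \<Rightarrow> bool" where
  "house_instance N H v \<longleftrightarrow> finite N \<and> finite H \<and> (\<forall>i\<in>N. \<forall>h\<in>H. 0 \<le> v i h)"

text \<open>An allocation maps an agent to \<open>None\<close> if the agent is assigned no house.\<close>

definition allocation :: "'a set \<Rightarrow> 'h set \<Rightarrow> ('a \<Rightarrow> 'h option) \<Rightarrow> bool" where
  "allocation N H A \<longleftrightarrow>
     (\<forall>i\<in>N. \<forall>h. A i = Some h \<longrightarrow> h \<in> H) \<and>
     (\<forall>i\<in>N. \<forall>j\<in>N. \<forall>h. A i = Some h \<and> A j = Some h \<longrightarrow> i = j)"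

fun val :: "('a \<Rightarrow> 'h \<Rightarrow> real) \<Rightarrow> 'a \<Rightarrow> 'h option \<Rightarrow> real" where
  "val v i None = 0"
| "val v i (Some h) = v i h"

definition envy_free :: "'a set \<Rightarrow> ('a \<Rightarrow> 'h \<Rightarrow> real) \<Rightarrow> ('a \<Rightarrow> 'h option) \<Rightarrow> bool" where
  "envy_free N v A \<longleftrightarrow> (\<forall>i\<in>N. \<forall>j\<in>N. val v i (A j) \<le> val v i (A i))"

definition min_value :: "('a \<Rightarrow> 'h \<Rightarrow> real) \<Rightarrow> 'a set \<Rightarrow> ('a \<Rightarrow> 'h option) \<Rightarrow> real" where
  "min_value v S A = Min ((\<lambda>i. val v i (A i)) ` S)"

definition max_positive :: "'a set \<Rightarrow> 'h set \<Rightarrow> ('a \<Rightarrow> 'h \<Rightarrow> real) \<Rightarrow> nat" where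
  "max_positive N H v = Max {card {i\<in>N. 0 < val v i (A i)} | A. allocation N H A}"

text \<open>
  If \<open>N\<close> is empty (first case) or no agent can receive a positive value (second case with
  \<open>k = 0\<close>), all welfares compared below are the same constant \<open>Min {}\<close>, so every allocation
  is welfare maximizing, in accordance with the reading ``first maximize the number of agents
  with positive value, then the minimum value among them''.
\<close>

definition egal_max :: "'a set \<Rightarrow> 'h set \<Rightarrow> ('a \<Rightarrow> 'h \<Rightarrow> real) \<Rightarrow> ('a \<Rightarrow> 'h option) \<Rightarrow> bool" where
  "egal_max N H v A \<longleftrightarrow> allocation N H A \<and>
     (if \<exists>B. allocation N H B \<and> (\<forall>i\<in>N. 0 < val v i (B i))
      then \<forall>B. allocation N H B \<longrightarrow> min_value v N B \<le> min_value v N A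
      else let k = max_positive N H v in
        \<exists>S\<subseteq>N. card S = k \<and>
          (\<forall>B T. allocation N H B \<and> T \<subseteq> N \<and> card T = k \<longrightarrow> min_value v T B \<le> min_value v S A))"


section \<open>Model of computation\<close>

text \<open>
  Programs of an additive random access machine with separate memories for natural numbers and
  for reals. A cell is addressed by a name and a list of indices computed from natural numbers
  (no index for a scalar variable, two indices for a matrix). Every elementary command and every
  test costs one unit; since a program is a fixed finite object, this differs from charging for
  each individual operation by at most a constant factor.

  The operations are chosen such that the unit cost measure is adequate. There is no
  multiplication, so \<open>t\<close> steps increase the bit length of the numbers by at most \<open>O(t)\<close>, and on
  rational input given in binary a run of \<open>t\<close> steps takes time polynomial in \<open>t\<close> and
  the input length on a Turing machine. There is no rounding from reals to natural numbers, and
  constants in real expressions are rational, so no information can be hidden in a program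
  constant.
\<close>

type_synonym vname = string

datatype nexp =
    NConst nat
  | NVar vname "nexp list"
  | NAdd nexp nexp
  | NSub nexp nexp

datatype rexp =
    RConst rat
  | RVar vname "nexp list"
  | RAdd rexp rexp
  | RSub rexp rexp

datatype bexp =
    NLess nexp nexp
  | RLess rexp rexp
  | BNot bexp
  | BAnd bexp bexp

datatype com =
    Skip
  | NAssign vname "nexp list" nexp
  | RAssign vname "nexp list" rexp
  | Seq com com
  | Cond bexp com com
  | While bexp com

type_synonym nat_mem = "vname \<Rightarrow> nat list \<Rightarrow> nat"
type_synonym real_mem = "vname \<Rightarrow> nat list \<Rightarrow> real"
type_synonym state = "nat_mem \<times> real_mem"

primrec nval :: "nat_mem \<Rightarrow> nexp \<Rightarrow> nat" where
  "nval \<sigma> (NConst c) = c"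
| "nval \<sigma> (NVar x is) = \<sigma> x (map (nval \<sigma>) is)"
| "nval \<sigma> (NAdd a b) = nval \<sigma> a + nval \<sigma> b"
| "nval \<sigma> (NSub a b) = nval \<sigma> a - nval \<sigma> b"

primrec rval :: "nat_mem \<Rightarrow> real_mem \<Rightarrow> rexp \<Rightarrow> real" where
  "rval \<sigma> \<rho> (RConst q) = of_rat q"
| "rval \<sigma> \<rho> (RVar x is) = \<rho> x (map (nval \<sigma>) is)"
| "rval \<sigma> \<rho> (RAdd a b) = rval \<sigma> \<rho> a + rval \<sigma> \<rho> b"
| "rval \<sigma> \<rho> (RSub a b) = rval \<sigma> \<rho> a - rval \<sigma> \<rho> b"

primrec bval :: "nat_mem \<Rightarrow> real_mem \<Rightarrow> bexp \<Rightarrow> bool" where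
  "bval \<sigma> \<rho> (NLess a b) \<longleftrightarrow> nval \<sigma> a < nval \<sigma> b"
| "bval \<sigma> \<rho> (RLess a b) \<longleftrightarrow> rval \<sigma> \<rho> a < rval \<sigma> \<rho> b"
| "bval \<sigma> \<rho> (BNot b) \<longleftrightarrow> \<not> bval \<sigma> \<rho> b"
| "bval \<sigma> \<rho> (BAnd b c) \<longleftrightarrow> bval \<sigma> \<rho> b \<and> bval \<sigma> \<rho> c"

definition update :: "('x \<Rightarrow> 'i \<Rightarrow> 'c) \<Rightarrow> 'x \<Rightarrow> 'i \<Rightarrow> 'c \<Rightarrow> ('x \<Rightarrow> 'i \<Rightarrow> 'c)" where
  "update \<sigma> x i c = \<sigma>(x := (\<sigma> x)(i := c))"

text \<open>\<open>exec c s t s'\<close>: started in \<open>s\<close>, program \<open>c\<close> halts after exactly \<open>t\<close> steps in \<open>s'\<close>.\<close>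

inductive exec :: "com \<Rightarrow> state \<Rightarrow> nat \<Rightarrow> state \<Rightarrow> bool" where
  Skip: "exec Skip s 1 s"
| NAssign: "exec (NAssign x is a) (\<sigma>, \<rho>) 1 (update \<sigma> x (map (nval \<sigma>) is) (nval \<sigma> a), \<rho>)"
| RAssign: "exec (RAssign x is a) (\<sigma>, \<rho>) 1 (\<sigma>, update \<rho> x (map (nval \<sigma>) is) (rval \<sigma> \<rho> a))"
| Seq: "exec c s t s' \<Longrightarrow> exec d s' u s'' \<Longrightarrow> exec (Seq c d) s (t + u) s''"
| CondTrue: "bval \<sigma> \<rho> b \<Longrightarrow> exec c (\<sigma>, \<rho>) t s' \<Longrightarrow> exec (Cond b c d) (\<sigma>, \<rho>) (t + 1) s'"
| CondFalse: "\<not> bval \<sigma> \<rho> b \<Longrightarrow> exec d (\<sigma>, \<rho>) t s' \<Longrightarrow> exec (Cond b c d) (\<sigma>, \<rho>) (t + 1) s'"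
| WhileFalse: "\<not> bval \<sigma> \<rho> b \<Longrightarrow> exec (While b c) (\<sigma>, \<rho>) 1 (\<sigma>, \<rho>)"
| WhileTrue: "bval \<sigma> \<rho> b \<Longrightarrow> exec c (\<sigma>, \<rho>) t s' \<Longrightarrow> exec (While b c) s' u s'' \<Longrightarrow>
    exec (While b c) (\<sigma>, \<rho>) (t + u + 1) s''"

lemma exec_deterministic:
  "exec c s t s' \<Longrightarrow> exec c s u s'' \<Longrightarrow> u = t \<and> s'' = s'"
proof (induction arbitrary: u s'' rule: exec.induct)
  case Skip
  from Skip.prems show ?case by cases auto
next
  case NAssign
  from NAssign.prems show ?case by cases auto
next
  case RAssign
  from RAssign.prems show ?case by cases auto
next
  case Seq
  from Seq.prems show ?case by cases (use Seq.IH in blast)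
next
  case CondTrue
  from CondTrue.prems CondTrue.hyps CondTrue.IH show ?case by cases blast+
next
  case CondFalse
  from CondFalse.prems CondFalse.hyps CondFalse.IH show ?case by cases blast+
next
  case WhileFalse
  from WhileFalse.prems WhileFalse.hyps show ?case by cases auto
next
  case WhileTrue
  from WhileTrue.prems WhileTrue.hyps WhileTrue.IH show ?case by cases blast+
qed


section \<open>Input and output\<close>

text \<open>
  An instance with \<open>n\<close> agents \<open>{..<n}\<close> and \<open>m\<close> houses \<open>{..<m}\<close> is given by the two numbers and
  the valuation matrix; all other memory cells are initially zero.
\<close>

definition input_state :: "nat \<Rightarrow> nat \<Rightarrow> (nat \<Rightarrow> nat \<Rightarrow> real) \<Rightarrow> state" where
  "input_state n m v =
    ((\<lambda>x is. if x = ''n'' \<and> is = [] then n else if x = ''m'' \<and> is = [] then m else 0),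
     (\<lambda>x is. case is of
         [i, h] \<Rightarrow> if x = ''v'' \<and> i < n \<and> h < m then v i h else 0
       | _ \<Rightarrow> 0))"

text \<open>The flag \<open>found\<close> is 1 if an allocation is returned, and 0 if its non-existence is reported.\<close>

definition output_flag :: "state \<Rightarrow> nat" where
  "output_flag s = fst s ''found'' []"

text \<open>Entry \<open>i\<close> of the array \<open>A\<close> is 0 if agent \<open>i\<close> gets nothing, and \<open>h + 1\<close> if it gets house \<open>h\<close>.\<close>

definition output_alloc :: "state \<Rightarrow> nat \<Rightarrow> nat option" where
  "output_alloc s i = (case fst s ''A'' [i] of 0 \<Rightarrow> None | Suc h \<Rightarrow> Some h)"

end

(*
  Call an agent interested if it values some house positively. In an envy-free allocation a house
  liked by an agent of value 0 is unassigned, so the allocation can maximize the number of agents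
  with positive value only if all interested agents have positive value. Among the envy-free
  matchings that saturate the interested agents with positive values, one is best for all agents
  simultaneously. It is found by an auction in which an unassigned agent bids for a favourite
  house with the fewest bids so far and evicts its holder; a house with more than n bids cannot
  occur in any such matching and is discarded. If this matching is not egalitarian welfare
  maximizing, then no envy-free allocation is. To test this, let t be its minimum value: it must
  be impossible to give all interested agents houses of value greater than t. This is an instance
  of the same problem, with valuations 1 above t and 0 elsewhere, because an allocation in which
  everybody gets value 1 is envy-free.
*)

theory Submission
  imports Defs
begin

section \<open>Envy-free matchings\<close>

text \<open>A greedy assignment can fail for two reasons: a wrong choice among equally good houses,
  which reassignment repairs, or too many agents insisting on the same favourites, which must then
  be given up for good. Telling these apart would ordinarily call for augmenting paths and Hall
  violators. Bid counts decide it with counters and comparisons alone; they act like the distance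
  labels of a push-relabel matching algorithm. Preferring few bids keeps the label of a held house
  within one of the labels of all equally good remaining houses, and this is what makes
  \<open>n\<close> the right limit. Simultaneous optimality comes from one-sided elimination: only
  houses unusable in every envy-free matching of the interested agents are removed, and each holder
  has a favourite among the rest. The result bounds all these matchings pointwise, hence also their
  minima, so a single welfare test settles every candidate.\<close>

definition ef_matching :: "'a set \<Rightarrow> 'h set \<Rightarrow> ('a \<Rightarrow> 'h \<Rightarrow> real) \<Rightarrow> ('a \<Rightarrow> 'h) \<Rightarrow> bool" where
  "ef_matching S H w B \<longleftrightarrow> inj_on B S \<and> B ` S \<subseteq> H \<and> (\<forall>i\<in>S. 0 < w i (B i)) \<and>
     (\<forall>i\<in>S. \<forall>j\<in>S. w i (B j) \<le> w i (B i))"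

text \<open>Says that the minimum value of \<open>B\<close> over \<open>S\<close> can be strictly
  exceeded, without using \<open>Min\<close>. The competitor \<open>C\<close> may cause envy because
  welfare is compared among all allocations. For empty \<open>S\<close> the property holds
  vacuously, hence the separate treatment of \<open>S = {}\<close> below.\<close>

definition dominated :: "'a set \<Rightarrow> 'h set \<Rightarrow> ('a \<Rightarrow> 'h \<Rightarrow> real) \<Rightarrow> ('a \<Rightarrow> 'h) \<Rightarrow> bool" where
  "dominated S H v B \<longleftrightarrow>
     (\<exists>C. inj_on C S \<and> C ` S \<subseteq> H \<and> (\<forall>i\<in>S. \<exists>j\<in>S. v j (B j) < v i (C i)))"

definition interested :: "'a set \<Rightarrow> 'h set \<Rightarrow> ('a \<Rightarrow> 'h \<Rightarrow> real) \<Rightarrow> 'a set" where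
  "interested N H v = {i \<in> N. \<exists>h\<in>H. 0 < v i h}"

definition alloc_of :: "'a set \<Rightarrow> ('a \<Rightarrow> 'h) \<Rightarrow> 'a \<Rightarrow> 'h option" where
  "alloc_of S B i = (if i \<in> S then Some (B i) else None)"

abbreviation positives :: "'a set \<Rightarrow> ('a \<Rightarrow> 'h \<Rightarrow> real) \<Rightarrow> ('a \<Rightarrow> 'h option) \<Rightarrow> 'a set" where
  "positives N v A \<equiv> {i\<in>N. 0 < val v i (A i)}"

lemma allocation_alloc_of:
  assumes "inj_on B S" "B ` S \<subseteq> H"
  shows "allocation N H (alloc_of S B)"
  using assms unfolding allocation_def alloc_of_def by (auto dest: inj_onD)

lemma allocation_the:
  assumes alloc: "allocation N H A" and "S \<subseteq> N" and "\<And>i. i \<in> S \<Longrightarrow> A i \<noteq> None"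
  shows "inj_on (the \<circ> A) S" and "(the \<circ> A) ` S \<subseteq> H"
proof -
  have Some: "i \<in> N" "A i = Some (the (A i))" if "i \<in> S" for i
    using that assms(2,3) by auto
  show "inj_on (the \<circ> A) S"
  proof (rule inj_onI)
    fix i j assume ij: "i \<in> S" "j \<in> S" "(the \<circ> A) i = (the \<circ> A) j"
    then have "A j = Some (the (A i))" using Some(2)[of j] by simp
    then show "i = j"
      using alloc Some[OF ij(1)] Some(1)[OF ij(2)] unfolding allocation_def by blast
  qed
  show "(the \<circ> A) ` S \<subseteq> H"
    using alloc Some unfolding allocation_def by fastforce
qed

lemma card_positives_le:
  assumes "finite N" "allocation N H A"
  shows "card (positives N v A) \<le> max_positive N H v"
proof -
  have "finite {card (positives N v A) | A. allocation N H A}"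
    by (rule finite_subset[of _ "{..card N}"]) (auto intro: card_mono assms(1))
  then show ?thesis
    unfolding max_positive_def using assms(2) by (intro Max_ge) auto
qed

lemma max_positive_attained:
  assumes "finite N"
  obtains A where "allocation N H A" "card (positives N v A) = max_positive N H v"
proof -
  let ?X = "{card (positives N v A) | A. allocation N H A}"
  have "finite ?X"
    by (rule finite_subset[of _ "{..card N}"]) (auto intro: card_mono assms(1))
  moreover have "allocation N H (\<lambda>_. None)"
    by (simp add: allocation_def)
  then have "?X \<noteq> {}" by blast
  ultimately have "max_positive N H v \<in> ?X"
    unfolding max_positive_def by (rule Max_in)
  then obtain A where "allocation N H A" "max_positive N H v = card (positives N v A)"
    by auto
  then show ?thesis using that by metis
qed

lemma positives_subset_interested:
  assumes "allocation N H A"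
  shows "positives N v A \<subseteq> interested N H v"
proof
  fix i assume i: "i \<in> positives N v A"
  then show "i \<in> interested N H v"
    using assms by (cases "A i") (auto simp: interested_def allocation_def)
qed

section \<open>Minimum values and egalitarian maximizers\<close>

lemma less_min_value_iff:
  assumes "finite S" "S \<noteq> {}"
  shows "x < min_value v S A \<longleftrightarrow> (\<forall>i\<in>S. x < val v i (A i))"
  using assms unfolding min_value_def by (subst Min_gr_iff) auto

lemma min_value_less_iff:
  assumes "finite S" "S \<noteq> {}"
  shows "min_value v S A < x \<longleftrightarrow> (\<exists>i\<in>S. val v i (A i) < x)"
  using assms unfolding min_value_def by (subst Min_less_iff) auto

lemma min_value_less_min_value_iff:
  assumes "finite S" "S \<noteq> {}" "finite T" "T \<noteq> {}"
  shows "min_value v S A < min_value v T C \<longleftrightarrow>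
    (\<forall>i\<in>T. \<exists>j\<in>S. val v j (A j) < val v i (C i))"
  using assms by (simp add: less_min_value_iff min_value_less_iff)

lemma all_positive_iff:
  assumes "finite N"
  shows "(\<exists>A. allocation N H A \<and> (\<forall>i\<in>N. 0 < val v i (A i))) \<longleftrightarrow> max_positive N H v = card N"
proof
  assume "\<exists>A. allocation N H A \<and> (\<forall>i\<in>N. 0 < val v i (A i))"
  then obtain A where A: "allocation N H A" "positives N v A = N" by auto
  obtain B where "card (positives N v B) = max_positive N H v"
    using max_positive_attained[OF assms] .
  moreover have "card (positives N v B) \<le> card N"
    using assms by (auto intro: card_mono)
  ultimately show "max_positive N H v = card N"
    using card_positives_le[OF assms A(1), of v] A(2) by simp
next
  assume max: "max_positive N H v = card N"
  obtain B where B: "allocation N H B" "card (positives N v B) = max_positive N H v"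
    using max_positive_attained[OF assms] .
  then have "positives N v B = N"
    using assms max by (intro card_subset_eq) auto
  then show "\<exists>A. allocation N H A \<and> (\<forall>i\<in>N. 0 < val v i (A i))"
    using B(1) by blast
qed

text \<open>If \<open>max_positive N H v = card N\<close>, the only subset of that size is
  \<open>N\<close> itself, so the first case of \<open>egal_max\<close> is an instance of the second
  and one formula serves both.\<close>

lemma egal_max_alt:
  assumes "finite N"
  shows "egal_max N H v A \<longleftrightarrow> allocation N H A \<and>
    (\<exists>S\<subseteq>N. card S = max_positive N H v \<and>
      (\<forall>B T. allocation N H B \<and> T \<subseteq> N \<and> card T = max_positive N H v
        \<longrightarrow> min_value v T B \<le> min_value v S A))"
proof (cases "max_positive N H v = card N")
  case True
  have *: "T \<subseteq> N \<and> card T = card N \<and> P \<longleftrightarrow> T = N \<and> P" for T P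
    using card_subset_eq[OF assms, of T] by auto
  have **: "T \<subseteq> N \<and> card T = card N \<longleftrightarrow> T = N" for T
    using * [of T True] by simp
  show ?thesis
    unfolding egal_max_def all_positive_iff[OF assms] True * ** by simp
next
  case False
  then show ?thesis
    unfolding egal_max_def all_positive_iff[OF assms] by (simp add: Let_def)
qed

text \<open>Some allocation has \<open>max_positive N H v\<close> positive agents and thus a
  positive minimum over them. The minimum over the set \<open>S\<close> from the definition is at
  least as large, so \<open>S\<close> consists of positive agents, and its cardinality leaves room
  for no others.\<close>

lemma egal_max_positives:
  assumes N: "finite N" and A: "egal_max N H v A"
  obtains S where "S = positives N v A" "card S = max_positive N H v"
    "\<And>B T. allocation N H B \<Longrightarrow> T \<subseteq> N \<Longrightarrow> card T = max_positive N H v \<Longrightarrow>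
      min_value v T B \<le> min_value v S A"
proof -
  have alloc: "allocation N H A" using A by (simp add: egal_max_def)
  from A have "\<exists>S\<subseteq>N. card S = max_positive N H v \<and>
      (\<forall>B T. allocation N H B \<and> T \<subseteq> N \<and> card T = max_positive N H v
        \<longrightarrow> min_value v T B \<le> min_value v S A)"
    by (rule egal_max_alt[OF N, THEN iffD1, THEN conjunct2])
  then obtain S where S: "S \<subseteq> N" "card S = max_positive N H v"
    and "\<forall>B T. allocation N H B \<and> T \<subseteq> N \<and> card T = max_positive N H v
        \<longrightarrow> min_value v T B \<le> min_value v S A"
    by (elim exE conjE)
  then have max: "min_value v T B \<le> min_value v S A"
    if "allocation N H B" "T \<subseteq> N" "card T = max_positive N H v" for B T
    using that by simp
  have "S \<subseteq> positives N v A"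
  proof (cases "S = {}")
    case False
    have fin: "finite S" using S N finite_subset by blast
    obtain B where B: "allocation N H B" "card (positives N v B) = max_positive N H v"
      using max_positive_attained[OF N] .
    have "positives N v B \<noteq> {}"
      using B(2) S(2) False fin by fastforce
    then have "0 < min_value v (positives N v B) B"
      using N by (subst less_min_value_iff) auto
    also have "\<dots> \<le> min_value v S A"
      using B by (intro max) auto
    finally show ?thesis
      using fin False S(1) by (subst (asm) less_min_value_iff) auto
  qed simp
  moreover have "card (positives N v A) \<le> card S"
    using card_positives_le[OF N alloc, of v] S(2) by simp
  ultimately have "S = positives N v A"
    using N by (intro card_seteq) auto
  then show ?thesis using that S max by blast
qed

text \<open>By envy-freeness, nobody owns a house that is liked by an agent without positive value. Such
  an agent could be given the house, so the number of agents with positive value is not maximal.\<close>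

lemma ef_egal_max_positives:
  assumes N: "finite N" and A: "egal_max N H v A" and ef: "envy_free N v A"
  shows "positives N v A = interested N H v"
proof
  have alloc: "allocation N H A" using A by (simp add: egal_max_def)
  then show "positives N v A \<subseteq> interested N H v"
    by (rule positives_subset_interested)
  show "interested N H v \<subseteq> positives N v A"
  proof (rule ccontr)
    assume "\<not> interested N H v \<subseteq> positives N v A"
    then obtain i h where i: "i \<in> N" "h \<in> H" "0 < v i h" "\<not> 0 < val v i (A i)"
      unfolding interested_def by auto
    have free: "A j \<noteq> Some h" if "j \<in> N" for j
    proof
      assume "A j = Some h"
      then have "v i h \<le> val v i (A i)"
        using ef i(1) that unfolding envy_free_def by fastforce
      then show False using i by simp
    qed
    let ?A = "A(i := Some h)"
    have "allocation N H ?A"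
      using alloc free i(2) unfolding allocation_def by auto
    then have "card (positives N v ?A) \<le> max_positive N H v"
      by (rule card_positives_le[OF N])
    moreover have "positives N v ?A = insert i (positives N v A)"
      using i by auto
    moreover have "card (positives N v A) = max_positive N H v"
      using egal_max_positives[OF N A] by metis
    ultimately show False
      using i N by simp
  qed
qed

text \<open>A dominating matching, read as an allocation, would have a larger minimum over the same
  set \<open>S\<close>, whose size is already the maximal one.\<close>

lemma ef_egal_max_imp_ef_matching:
  assumes inst: "house_instance N H v" and A: "egal_max N H v A" and ef: "envy_free N v A"
  defines "S \<equiv> interested N H v"
  shows "ef_matching S H v (the \<circ> A) \<and> (S = {} \<or> \<not> dominated S H v (the \<circ> A))"
proof -
  have N: "finite N" using inst by (simp add: house_instance_def)
  have S: "S = positives N v A"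
    unfolding S_def using ef_egal_max_positives[OF N A ef] by simp
  have fin: "finite S" and SN: "S \<subseteq> N"
    using N unfolding S by auto
  have alloc: "allocation N H A" using A by (simp add: egal_max_def)
  have Some: "A i = Some (the (A i))" if "i \<in> S" for i
    using that unfolding S by (cases "A i") auto
  have val: "val v j (A i) = v j (the (A i))" if "i \<in> S" for i j
    using Some[OF that] by (metis val.simps(2))
  have "ef_matching S H v (the \<circ> A)"
    unfolding ef_matching_def
  proof (intro conjI ballI)
    show "inj_on (the \<circ> A) S" "(the \<circ> A) ` S \<subseteq> H"
      using allocation_the[OF alloc SN] Some by (metis option.discI)+
    show "0 < v i ((the \<circ> A) i)" if "i \<in> S" for i
      using that val[OF that, of i] unfolding S by simp
    show "v i ((the \<circ> A) j) \<le> v i ((the \<circ> A) i)" if "i \<in> S" "j \<in> S" for i j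
      using ef that SN val[of i i] val[of j i] unfolding envy_free_def by force
  qed
  moreover have False if ne: "S \<noteq> {}" and dom: "dominated S H v (the \<circ> A)"
  proof -
    obtain C where C: "inj_on C S" "C ` S \<subseteq> H" "\<forall>i\<in>S. \<exists>j\<in>S. v j (the (A j)) < v i (C i)"
      using dom unfolding dominated_def by auto
    have "min_value v S A < min_value v S (alloc_of S C)"
      using C(3) val by (subst min_value_less_min_value_iff[OF fin ne fin ne])
        (simp add: alloc_of_def)
    moreover have "min_value v S (alloc_of S C) \<le> min_value v S A"
      using egal_max_positives[OF N A] allocation_alloc_of[OF C(1,2)] SN S by metis
    ultimately show False by simp
  qed
  ultimately show ?thesis by blast
qed

text \<open>Agents outside \<open>S\<close> value no house, so they neither envy nor can be
  positive, and \<open>card S\<close> is the maximal number. A competing allocation with a larger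
  minimum over a set of that size is positive on this set, which must therefore be \<open>S\<close>;
  it thus yields a dominating matching.\<close>

lemma ef_matching_imp_ef_egal_max:
  assumes inst: "house_instance N H v"
  defines "S \<equiv> interested N H v"
  assumes B: "ef_matching S H v B" and nd: "S = {} \<or> \<not> dominated S H v B"
  shows "allocation N H (alloc_of S B) \<and> envy_free N v (alloc_of S B) \<and>
    egal_max N H v (alloc_of S B)"
proof -
  have N: "finite N" using inst by (simp add: house_instance_def)
  have SN: "S \<subseteq> N" unfolding S_def interested_def by auto
  have fin: "finite S" using SN N finite_subset by blast
  have inj: "inj_on B S" and BH: "B ` S \<subseteq> H"
    using B by (auto simp: ef_matching_def)
  have alloc: "allocation N H (alloc_of S B)"
    using inj BH by (rule allocation_alloc_of)
  have zero: "v i h = 0" if "i \<in> N - S" "h \<in> H" for i h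
    using that inst unfolding S_def interested_def house_instance_def by force
  have "envy_free N v (alloc_of S B)"
    unfolding envy_free_def
  proof (intro ballI)
    fix i j assume ij: "i \<in> N" "j \<in> N"
    show "val v i (alloc_of S B j) \<le> val v i (alloc_of S B i)"
      using B zero[of i] ij BH unfolding ef_matching_def alloc_of_def
      by (cases "i \<in> S"; cases "j \<in> S") (auto intro: less_imp_le)
  qed
  moreover have pos: "positives N v (alloc_of S B) = S"
    using B SN unfolding ef_matching_def alloc_of_def by auto
  then have le: "card S \<le> max_positive N H v"
    using card_positives_le[OF N alloc, of v] by simp
  obtain C where "allocation N H C" "card (positives N v C) = max_positive N H v"
    using max_positive_attained[OF N] .
  then have ge: "max_positive N H v \<le> card S"
    using positives_subset_interested[of N H C v] card_mono[OF fin, of "positives N v C"]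
    unfolding S_def by simp
  have "min_value v T C \<le> min_value v S (alloc_of S B)"
    if C: "allocation N H C" and T: "T \<subseteq> N" "card T = card S" for T C
  proof (rule ccontr)
    assume less: "\<not> min_value v T C \<le> min_value v S (alloc_of S B)"
    have finT: "finite T" using T N finite_subset by blast
    \<comment> \<open>With \<open>S\<close> empty, \<open>T\<close> would be empty too, and both
      sides would be the same \<open>Min {}\<close>.\<close>
    have ne: "S \<noteq> {}"
      using less T finT by (cases "S = {}") (auto simp: min_value_def)
    then have neT: "T \<noteq> {}" using T fin by auto
    have *: "\<forall>i\<in>T. \<exists>j\<in>S. v j (B j) < val v i (C i)"
      using less min_value_less_min_value_iff[OF fin ne finT neT, of v "alloc_of S B" C]
      by (simp add: alloc_of_def)
    moreover have Bpos: "0 < v j (B j)" if "j \<in> S" for j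
      using B that by (simp add: ef_matching_def)
    ultimately have Cpos: "0 < val v i (C i)" if "i \<in> T" for i
      using that less_trans by blast
    then have "T \<subseteq> positives N v C" using T by auto
    then have "T \<subseteq> S"
      using positives_subset_interested[OF C] unfolding S_def by blast
    then have "T = S" using fin T by (intro card_subset_eq)
    have Some: "C i = Some (the (C i))" if "i \<in> S" for i
      using Cpos[of i] that \<open>T = S\<close> by (cases "C i") auto
    have "dominated S H v B"
      unfolding dominated_def
    proof (intro exI[of _ "the \<circ> C"] conjI)
      show "inj_on (the \<circ> C) S" "(the \<circ> C) ` S \<subseteq> H"
        using allocation_the[OF C SN] Some by (metis option.discI)+
      show "\<forall>i\<in>S. \<exists>j\<in>S. v j (B j) < v i ((the \<circ> C) i)"
      proof
        fix i assume i: "i \<in> S"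
        then have "val v i (C i) = v i ((the \<circ> C) i)"
          using Some[OF i] by (metis comp_apply val.simps(2))
        then show "\<exists>j\<in>S. v j (B j) < v i ((the \<circ> C) i)"
          using * i unfolding \<open>T = S\<close> by metis
      qed
    qed
    then show False using nd ne by blast
  qed
  then have "egal_max N H v (alloc_of S B)"
    unfolding egal_max_alt[OF N] using alloc SN le ge by (metis le_antisym)
  ultimately show ?thesis using alloc by blast
qed


section \<open>The domination test\<close>

lemma ef_matching_cong:
  assumes "\<And>i h. i \<in> S \<Longrightarrow> h \<in> H \<Longrightarrow> w i h = w' i h"
  shows "ef_matching S H w B \<longleftrightarrow> ef_matching S H w' B"
proof (cases "B ` S \<subseteq> H")
  case True
  then have "w i (B j) = w' i (B j)" if "i \<in> S" "j \<in> S" for i j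
    using assms that by blast
  then show ?thesis unfolding ef_matching_def by simp
qed (simp add: ef_matching_def)

text \<open>For 0-1 valuations, envy-freeness is no restriction on a matching of positive values.\<close>

lemma dominated_iff_ef_matching:
  "dominated S H v b \<longleftrightarrow>
    (\<exists>B. ef_matching S H (\<lambda>i h. of_bool (\<exists>j\<in>S. v j (b j) < v i h)) B)"
  unfolding dominated_def ef_matching_def by (intro ex_cong) auto

text \<open>Every envy-free matching of \<open>S\<close> is pointwise at most \<open>b\<close>, so
  whatever dominates \<open>b\<close> dominates it as well.\<close>

lemma no_ef_egal_max_if_dominated:
  assumes inst: "house_instance N H v"
  defines "S \<equiv> interested N H v"
  assumes opt: "\<And>B i. ef_matching S H v B \<Longrightarrow> i \<in> S \<Longrightarrow> v i (B i) \<le> v i (b i)"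
    and dom: "S \<noteq> {}" "dominated S H v b"
  shows "\<not> (envy_free N v A \<and> egal_max N H v A)"
proof
  assume "envy_free N v A \<and> egal_max N H v A"
  then have A: "ef_matching S H v (the \<circ> A)" "\<not> dominated S H v (the \<circ> A)"
    using ef_egal_max_imp_ef_matching[OF inst] dom(1) unfolding S_def by blast+
  obtain C where C: "inj_on C S" "C ` S \<subseteq> H" "\<forall>i\<in>S. \<exists>j\<in>S. v j (b j) < v i (C i)"
    using dom(2) unfolding dominated_def by blast
  then have "\<forall>i\<in>S. \<exists>j\<in>S. v j ((the \<circ> A) j) < v i (C i)"
    using opt[OF A(1)] by (meson le_less_trans)
  then show False using A(2) C(1,2) unfolding dominated_def by blast
qed


section \<open>The auction\<close>

text \<open>
  Agents bid for houses; the label of a house counts the bids for it, and a house is out of the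
  auction once it has received more than \<open>n\<close> bids. Entry \<open>a i\<close> is 0 if agent \<open>i\<close> holds no house,
  and \<open>h + 1\<close> if it holds house \<open>h\<close>.
\<close>

definition alive :: "nat \<Rightarrow> nat \<Rightarrow> (nat \<Rightarrow> nat) \<Rightarrow> nat \<Rightarrow> bool" where
  "alive n m d h \<longleftrightarrow> h < m \<and> d h \<le> n"

definition best_bid :: "nat \<Rightarrow> nat \<Rightarrow> (nat \<Rightarrow> nat \<Rightarrow> real) \<Rightarrow> (nat \<Rightarrow> nat) \<Rightarrow> nat \<Rightarrow> nat \<Rightarrow> bool" where
  "best_bid n m w d i g \<longleftrightarrow> alive n m d g \<and> 0 < w i g \<and>
     (\<forall>h. alive n m d h \<longrightarrow> w i h < w i g \<or> w i h = w i g \<and> d g \<le> d h)"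

text \<open>The slack in \<open>Suc (d h)\<close> is the holder's own bid: \<open>g\<close> had a
  least label when chosen and then grew by one, while other labels can only increase later. A house
  with a bid stays held until it is discarded, as eviction hands it to the bidder. The last clause
  is the soundness of discarding.\<close>

definition auction_inv ::
  "nat set \<Rightarrow> nat \<Rightarrow> nat \<Rightarrow> (nat \<Rightarrow> nat \<Rightarrow> real) \<Rightarrow> (nat \<Rightarrow> nat) \<Rightarrow> (nat \<Rightarrow> nat) \<Rightarrow> bool" where
  "auction_inv S n m w d a \<longleftrightarrow>
     (\<forall>i g. a i = Suc g \<longrightarrow> i \<in> S \<and> alive n m d g \<and> 0 < w i g \<and>
        (\<forall>h. alive n m d h \<longrightarrow> w i h < w i g \<or> w i h = w i g \<and> d g \<le> Suc (d h))) \<and>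
     (\<forall>i j g. a i = Suc g \<and> a j = Suc g \<longrightarrow> i = j) \<and>
     (\<forall>h. alive n m d h \<and> 0 < d h \<longrightarrow> (\<exists>i. a i = Suc h)) \<and>
     (\<forall>h<m. d h \<le> Suc n) \<and>
     (\<forall>B. ef_matching S {..<m} w B \<longrightarrow> (\<forall>i\<in>S. d (B i) \<le> n))"

lemma auction_invD:
  assumes "auction_inv S n m w d a"
  shows "a i = Suc g \<Longrightarrow> i \<in> S"
    and "a i = Suc g \<Longrightarrow> alive n m d g"
    and "a i = Suc g \<Longrightarrow> 0 < w i g"
    and "a i = Suc g \<Longrightarrow> alive n m d h \<Longrightarrow> w i h \<le> w i g"
    and "a i = Suc g \<Longrightarrow> alive n m d h \<Longrightarrow> w i h = w i g \<Longrightarrow> d g \<le> Suc (d h)"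
    and "a i = Suc g \<Longrightarrow> a j = Suc g \<Longrightarrow> i = j"
    and "alive n m d h \<Longrightarrow> 0 < d h \<Longrightarrow> \<exists>i. a i = Suc h"
    and "h < m \<Longrightarrow> d h \<le> Suc n"
    and "ef_matching S {..<m} w B \<Longrightarrow> i \<in> S \<Longrightarrow> alive n m d (B i)"
proof -
  note inv = assms[unfolded auction_inv_def]
  have holder: "i \<in> S \<and> alive n m d g \<and> 0 < w i g \<and>
      (\<forall>h. alive n m d h \<longrightarrow> w i h < w i g \<or> w i h = w i g \<and> d g \<le> Suc (d h))"
    if "a i = Suc g" for i g
    using inv[THEN conjunct1] that by blast
  show "a i = Suc g \<Longrightarrow> i \<in> S" "a i = Suc g \<Longrightarrow> alive n m d g" "a i = Suc g \<Longrightarrow> 0 < w i g"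
    using holder by blast+
  show "a i = Suc g \<Longrightarrow> alive n m d h \<Longrightarrow> w i h \<le> w i g"
    using holder[of i g] by force
  show "a i = Suc g \<Longrightarrow> alive n m d h \<Longrightarrow> w i h = w i g \<Longrightarrow> d g \<le> Suc (d h)"
    using holder[of i g] by force
  show "a i = Suc g \<Longrightarrow> a j = Suc g \<Longrightarrow> i = j"
    using inv[THEN conjunct2, THEN conjunct1] by blast
  show "alive n m d h \<Longrightarrow> 0 < d h \<Longrightarrow> \<exists>i. a i = Suc h"
    using inv[THEN conjunct2, THEN conjunct2, THEN conjunct1] by blast
  show "h < m \<Longrightarrow> d h \<le> Suc n"
    using inv[THEN conjunct2, THEN conjunct2, THEN conjunct2, THEN conjunct1] by blast
  show "alive n m d (B i)" if "ef_matching S {..<m} w B" "i \<in> S"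
    using inv[THEN conjunct2, THEN conjunct2, THEN conjunct2, THEN conjunct2] that
    unfolding alive_def ef_matching_def by blast
qed

text \<open>
  If the house \<open>g\<close> with \<open>n\<close> bids were used by \<open>B\<close>, then following \<open>i\<close> to the holder of \<open>B i\<close>, to
  the holder of \<open>B\<close> of this holder, and so on, would lead to \<open>n + 1\<close> different agents: the house
  that \<open>B\<close> gives to an agent on this walk is a favourite of the agent, hence labels decrease by
  at most one per step and every house on the way is held by someone.
\<close>

lemma exhausted_house_unused:
  assumes inv: "auction_inv S n m w d a" and S: "S \<subseteq> {..<n}"
    and i: "i \<in> S" "a i = 0" and g: "best_bid n m w d i g" "d g = n"
    and B: "ef_matching S {..<m} w B"
  shows "g \<notin> B ` S"
proof
  assume "g \<in> B ` S"
  then obtain l where l: "l \<in> S" "B l = g" by blast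
  note inv = auction_invD[OF inv]
  have Balive: "alive n m d (B j)" if "j \<in> S" for j
    using inv(9) B that .
  have ef: "w j (B k) \<le> w j (B j)" if "j \<in> S" "k \<in> S" for j k
    using B that by (simp add: ef_matching_def)
  define f where "f j = (SOME k. a k = Suc (B j))" for j
  define x where "x t = (f ^^ t) i" for t
  have walk: "x t \<in> S \<and> n - t \<le> d (B (x t)) \<and> (\<forall>h. alive n m d h \<longrightarrow> w (x t) h \<le> w (x t) (B (x t))) \<and>
      (\<forall>u. t = Suc u \<longrightarrow> a (x t) = Suc (B (x u)))" if "t \<le> n" for t
    using that
  proof (induction t)
    case 0
    \<comment> \<open>Agent \<open>l\<close> owns \<open>g\<close> under \<open>B\<close>, so
      \<open>i\<close>, whose favourite is \<open>g\<close>, must get an equally good house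
      \<open>B i\<close>; the tie rule for bids then gives it a label of at least
      \<open>n\<close>.\<close>
    have "w i g \<le> w i (B i)" using ef[of i l] i l by simp
    moreover have "w i (B i) < w i g \<or> w i (B i) = w i g \<and> d g \<le> d (B i)"
      using g(1) Balive[OF i(1)] unfolding best_bid_def by blast
    ultimately have eq: "w i (B i) = w i g" and "d g \<le> d (B i)" by auto
    moreover have "w i h \<le> w i g" if "alive n m d h" for h
      using g(1) that unfolding best_bid_def by fastforce
    ultimately show ?case using g(2) i by (simp add: x_def)
  next
    case (Suc t)
    let ?y = "x (Suc t)"
    from Suc have IH: "x t \<in> S" "n - t \<le> d (B (x t))" by auto
    then have "alive n m d (B (x t))" "0 < d (B (x t))"
      using Balive Suc.prems by auto
    then have "\<exists>k. a k = Suc (B (x t))" by (rule inv(7))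
    then have y: "a ?y = Suc (B (x t))"
      by (auto simp: x_def f_def intro: someI_ex)
    then have yS: "?y \<in> S" by (rule inv(1))
    have max: "w ?y h \<le> w ?y (B (x t))" if "alive n m d h" for h
      using inv(4)[OF y that] .
    have "w ?y (B (x t)) \<le> w ?y (B ?y)" using ef yS IH by blast
    with max have eq: "w ?y (B ?y) = w ?y (B (x t))"
      using Balive[OF yS] by force
    then have "d (B (x t)) \<le> Suc (d (B ?y))"
      using inv(5)[OF y Balive[OF yS]] by simp
    then show ?case using IH yS max eq y by auto
  qed
  \<comment> \<open>The start \<open>i\<close> holds no house while all later agents hold one, so
    the walk never returns to its start. Any other repetition means the same held house twice and,
    as \<open>B\<close> is injective, a repetition one step earlier.\<close>
  have "x s \<noteq> x t" if "s < t" "t \<le> n" for s t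
    using that
  proof (induction s arbitrary: t)
    case 0
    then obtain u where "t = Suc u" by (cases t) auto
    then show ?case using walk[of t] 0 i by (auto simp: x_def)
  next
    case (Suc s)
    then obtain u where u: "t = Suc u" by (cases t) auto
    have "x s \<noteq> x u" using Suc u by simp
    then have "B (x s) \<noteq> B (x u)"
      using B walk[of s] walk[of u] Suc.prems u unfolding ef_matching_def
      by (auto dest: inj_onD)
    then show ?case using walk[of "Suc s"] walk[of t] Suc.prems u by force
  qed
  then have "inj_on x {..n}"
    by (intro linorder_inj_onI) auto
  moreover have "x ` {..n} \<subseteq> {..<n}"
    using walk S by auto
  ultimately have "card {..n} \<le> card {..<n}"
    by (intro card_inj_on_le) auto
  then show False by simp
qed

text \<open>If \<open>g\<close> already has \<open>n\<close> bids, this bid discards it: the holder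
  is evicted, but the bidder does not get the house either.\<close>

definition bid :: "nat \<Rightarrow> (nat \<Rightarrow> nat) \<Rightarrow> nat \<Rightarrow> nat \<Rightarrow> (nat \<Rightarrow> nat) \<Rightarrow> nat \<Rightarrow> nat" where
  "bid n d i g a =
     (let a' = (\<lambda>j. if a j = Suc g then 0 else a j) in if d g < n then a'(i := Suc g) else a')"

text \<open>Labels only grow and the set of remaining houses only shrinks, so the conditions on
  holders of other houses survive. For the bidder, the slack of one absorbs the increment of its own
  house. Soundness of discarding is at stake only for \<open>d g = n\<close>, where
  \<open>exhausted_house_unused\<close> applies.\<close>

lemma auction_inv_bid:
  assumes inv: "auction_inv S n m w d a" and S: "S \<subseteq> {..<n}"
    and i: "i \<in> S" "a i = 0" and g: "best_bid n m w d i g"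
  shows "auction_inv S n m w (d(g := Suc (d g))) (bid n d i g a)"
proof -
  let ?d = "d(g := Suc (d g))" and ?a = "bid n d i g a"
  note invD = auction_invD[OF inv]
  have galive: "alive n m d g" and gpos: "0 < w i g" using g by (auto simp: best_bid_def)
  have alive: "alive n m d h" if "alive n m ?d h" for h
    using that by (auto simp: alive_def split: if_splits)
  have cases: "j = i \<and> h = g \<and> d g < n \<or> a j = Suc h \<and> h \<noteq> g \<and> j \<noteq> i" if "?a j = Suc h" for j h
    using that i(2) by (auto simp: bid_def Let_def split: if_splits)
  show ?thesis
    unfolding auction_inv_def
  proof (intro conjI allI impI ballI)
    fix j h assume j: "?a j = Suc h"
    show "j \<in> S" using cases[OF j] i(1) invD(1) by blast
    show "alive n m ?d h" using cases[OF j] galive invD(2)[of j h] by (auto simp: alive_def)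
    show "0 < w j h" using cases[OF j] gpos invD(3) by blast
    fix h' assume h': "alive n m ?d h'"
    show "w j h' < w j h \<or> w j h' = w j h \<and> ?d h \<le> Suc (?d h')"
      using cases[OF j]
    proof
      assume "j = i \<and> h = g \<and> d g < n"
      then show ?thesis using g alive[OF h'] by (auto simp: best_bid_def)
    next
      assume *: "a j = Suc h \<and> h \<noteq> g \<and> j \<noteq> i"
      then have "w j h' \<le> w j h" and "w j h' = w j h \<longrightarrow> d h \<le> Suc (d h')"
        using invD(4,5)[of j h h'] alive[OF h'] by auto
      then show ?thesis using * by auto
    qed
  next
    fix j k h assume "?a j = Suc h \<and> ?a k = Suc h"
    then show "j = k" using cases[of j h] cases[of k h] invD(6) by blast
  next
    fix h assume h: "alive n m ?d h \<and> 0 < ?d h"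
    show "\<exists>j. ?a j = Suc h"
    proof (cases "h = g")
      case True
      then have "?a i = Suc h" using h by (auto simp: bid_def alive_def)
      then show ?thesis ..
    next
      case False
      then obtain j where j: "a j = Suc h" using invD(7)[of h] alive h by auto
      then have "?a j = Suc h" using False i(2) by (auto simp: bid_def Let_def)
      then show ?thesis ..
    qed
  next
    fix h assume "h < m"
    then show "?d h \<le> Suc n" using invD(8) galive by (auto simp: alive_def)
  next
    fix B j assume B: "ef_matching S {..<m} w B" and "j \<in> S"
    then have "B j \<noteq> g" if "d g = n"
      using exhausted_house_unused[OF inv S i g that B] by blast
    moreover have "d (B j) \<le> n"
      using invD(9)[OF B \<open>j \<in> S\<close>] by (simp add: alive_def)
    ultimately show "?d (B j) \<le> n" by (cases "B j = g"; cases "d g = n") auto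
  qed
qed

lemma auction_inv_init: "auction_inv S n m w (\<lambda>_. 0) (\<lambda>_. 0)"
  by (simp add: auction_inv_def)

text \<open>All held houses are alive and each is a favourite of its holder among the alive ones,
  which excludes envy. Optimality takes no exchange argument: by the invariant, \<open>B\<close>
  uses only alive houses.\<close>

lemma auction_result:
  assumes inv: "auction_inv S n m w d a" and S: "\<forall>i\<in>S. a i \<noteq> 0"
  defines "b \<equiv> \<lambda>i. a i - 1"
  shows "ef_matching S {..<m} w b"
    and "ef_matching S {..<m} w B \<Longrightarrow> i \<in> S \<Longrightarrow> w i (B i) \<le> w i (b i)"
    and "i \<notin> S \<Longrightarrow> a i = 0"
proof -
  note invD = auction_invD[OF inv]
  have a: "a i = Suc (b i)" if "i \<in> S" for i
    using S that by (simp add: b_def)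
  show "ef_matching S {..<m} w b"
    unfolding ef_matching_def
  proof (intro conjI ballI)
    show "inj_on b S" using a invD(6) by (intro inj_onI) metis
    show "b ` S \<subseteq> {..<m}" using invD(2)[OF a] by (auto simp: alive_def)
    show "0 < w i (b i)" if "i \<in> S" for i using invD(3)[OF a[OF that]] .
    show "w i (b j) \<le> w i (b i)" if "i \<in> S" "j \<in> S" for i j
      using invD(4)[OF a[OF that(1)] invD(2)[OF a[OF that(2)]]] .
  qed
  show "w i (B i) \<le> w i (b i)" if "ef_matching S {..<m} w B" "i \<in> S"
    using invD(4)[OF a[OF that(2)] invD(9)[OF that]] .
  show "a i = 0" if "i \<notin> S"
    using that invD(1) by (cases "a i") auto
qed

text \<open>This justifies giving up: an envy-free matching would provide agent \<open>i\<close>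
  with an alive house of positive value.\<close>

lemma auction_stuck:
  assumes inv: "auction_inv S n m w d a" and i: "i \<in> S"
    and none: "\<forall>h. alive n m d h \<longrightarrow> \<not> 0 < w i h"
  shows "\<not> ef_matching S {..<m} w B"
proof
  assume B: "ef_matching S {..<m} w B"
  then have "alive n m d (B i)" using auction_invD(9)[OF inv] i by blast
  then show False using none B i by (auto simp: ef_matching_def)
qed


section \<open>Reasoning about programs\<close>

text \<open>Total correctness with a time bound, stated for a single start state. The postcondition
  may itself be a \<open>runs\<close> statement about the rest of the program, so sequencing becomes
  nesting.\<close>

definition runs ::
  "com \<Rightarrow> nat_mem \<Rightarrow> real_mem \<Rightarrow> nat \<Rightarrow> (nat_mem \<Rightarrow> real_mem \<Rightarrow> bool) \<Rightarrow> bool" where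
  "runs c \<sigma> \<rho> T Q \<longleftrightarrow> (\<exists>t \<sigma>' \<rho>'. exec c (\<sigma>, \<rho>) t (\<sigma>', \<rho>') \<and> t \<le> T \<and> Q \<sigma>' \<rho>')"

lemma runs_conseq:
  assumes "runs c \<sigma> \<rho> T P" "\<And>\<sigma>' \<rho>'. P \<sigma>' \<rho>' \<Longrightarrow> Q \<sigma>' \<rho>'"
  shows "runs c \<sigma> \<rho> T Q"
  using assms unfolding runs_def by meson

lemma runs_time:
  assumes "runs c \<sigma> \<rho> T Q" "T \<le> U"
  shows "runs c \<sigma> \<rho> U Q"
  using assms unfolding runs_def by (meson le_trans)

lemma runs_Skip: "Q \<sigma> \<rho> \<Longrightarrow> runs Skip \<sigma> \<rho> 1 Q"
  unfolding runs_def using exec.Skip by blast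

lemma runs_NAssign:
  "Q (update \<sigma> x (map (nval \<sigma>) is) (nval \<sigma> a)) \<rho> \<Longrightarrow> runs (NAssign x is a) \<sigma> \<rho> 1 Q"
  unfolding runs_def using exec.NAssign by blast

lemma runs_RAssign:
  "Q \<sigma> (update \<rho> x (map (nval \<sigma>) is) (rval \<sigma> \<rho> a)) \<Longrightarrow> runs (RAssign x is a) \<sigma> \<rho> 1 Q"
  unfolding runs_def using exec.RAssign by blast

lemma runs_Seq:
  assumes "runs c \<sigma> \<rho> T (\<lambda>\<sigma>' \<rho>'. runs d \<sigma>' \<rho>' U Q)"
  shows "runs (Seq c d) \<sigma> \<rho> (T + U) Q"
proof -
  obtain t \<sigma>' \<rho>' where 1: "exec c (\<sigma>, \<rho>) t (\<sigma>', \<rho>')" "t \<le> T" "runs d \<sigma>' \<rho>' U Q"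
    using assms unfolding runs_def by blast
  then obtain u \<sigma>'' \<rho>'' where 2: "exec d (\<sigma>', \<rho>') u (\<sigma>'', \<rho>'')" "u \<le> U" "Q \<sigma>'' \<rho>''"
    unfolding runs_def by blast
  show ?thesis
    unfolding runs_def using exec.Seq[OF 1(1) 2(1)] add_mono[OF 1(2) 2(2)] 2(3) by blast
qed

text \<open>The sum replaces a maximum so that time bounds are built from addition and
  multiplication only.\<close>

lemma runs_Cond:
  assumes "bval \<sigma> \<rho> b \<Longrightarrow> runs c \<sigma> \<rho> T Q" and "\<not> bval \<sigma> \<rho> b \<Longrightarrow> runs d \<sigma> \<rho> U Q"
  shows "runs (Cond b c d) \<sigma> \<rho> (T + U + 1) Q"
proof (cases "bval \<sigma> \<rho> b")
  case True
  then obtain t \<sigma>' \<rho>' where "exec c (\<sigma>, \<rho>) t (\<sigma>', \<rho>')" "t \<le> T" "Q \<sigma>' \<rho>'"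
    using assms(1) unfolding runs_def by blast
  moreover from this have "t + 1 \<le> T + U + 1" by simp
  ultimately show ?thesis
    unfolding runs_def using exec.CondTrue[OF True] by blast
next
  case False
  then obtain t \<sigma>' \<rho>' where "exec d (\<sigma>, \<rho>) t (\<sigma>', \<rho>')" "t \<le> U" "Q \<sigma>' \<rho>'"
    using assms(2) unfolding runs_def by blast
  moreover from this have "t + 1 \<le> T + U + 1" by simp
  ultimately show ?thesis
    unfolding runs_def using exec.CondFalse[OF False] by blast
qed

lemma runs_WhileFalse:
  assumes "\<not> bval \<sigma> \<rho> b" "Q \<sigma> \<rho>"
  shows "runs (While b c) \<sigma> \<rho> 1 Q"
  unfolding runs_def using exec.WhileFalse[OF assms(1)] assms(2) by blast

lemma runs_WhileTrue:
  assumes b: "bval \<sigma> \<rho> b" and "runs c \<sigma> \<rho> T (\<lambda>\<sigma>' \<rho>'. runs (While b c) \<sigma>' \<rho>' U Q)"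
  shows "runs (While b c) \<sigma> \<rho> (T + U + 1) Q"
proof -
  obtain t \<sigma>' \<rho>' where 1: "exec c (\<sigma>, \<rho>) t (\<sigma>', \<rho>')" "t \<le> T" "runs (While b c) \<sigma>' \<rho>' U Q"
    using assms(2) unfolding runs_def by blast
  then obtain u \<sigma>'' \<rho>'' where
    2: "exec (While b c) (\<sigma>', \<rho>') u (\<sigma>'', \<rho>'')" "u \<le> U" "Q \<sigma>'' \<rho>''"
    unfolding runs_def by blast
  have "t + u + 1 \<le> T + U + 1" using 1 2 by simp
  then show ?thesis
    unfolding runs_def using exec.WhileTrue[OF b 1(1) 2(1)] 2(3) by blast
qed

lemma runs_While:
  fixes \<mu> :: "nat_mem \<Rightarrow> real_mem \<Rightarrow> nat"
  assumes body: "\<And>\<sigma> \<rho>. I \<sigma> \<rho> \<Longrightarrow> bval \<sigma> \<rho> b \<Longrightarrow>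
      runs c \<sigma> \<rho> T (\<lambda>\<sigma>' \<rho>'. I \<sigma>' \<rho>' \<and> \<mu> \<sigma>' \<rho>' < \<mu> \<sigma> \<rho>)"
    and exit: "\<And>\<sigma> \<rho>. I \<sigma> \<rho> \<Longrightarrow> \<not> bval \<sigma> \<rho> b \<Longrightarrow> Q \<sigma> \<rho>"
    and init: "I \<sigma> \<rho>" and M: "\<mu> \<sigma> \<rho> \<le> M"
  shows "runs (While b c) \<sigma> \<rho> (M * (T + 1) + 1) Q"
  using init M
proof (induction M arbitrary: \<sigma> \<rho>)
  case 0
  then have "\<not> bval \<sigma> \<rho> b"
    using body unfolding runs_def by fastforce
  then show ?case using runs_WhileFalse exit 0 by fastforce
next
  case (Suc M)
  show ?case
  proof (cases "bval \<sigma> \<rho> b")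
    case True
    have "runs c \<sigma> \<rho> T (\<lambda>\<sigma>' \<rho>'. runs (While b c) \<sigma>' \<rho>' (M * (T + 1) + 1) Q)"
      by (rule runs_conseq[OF body[OF Suc.prems(1) True]]) (use Suc in auto)
    from runs_WhileTrue[OF True this] show ?thesis
      by (rule runs_time) simp
  next
    case False
    from runs_WhileFalse[OF this] show ?thesis
      by (rule runs_time) (use exit Suc False in auto)
  qed
qed

section \<open>Counting loops\<close>

definition for_loop :: "vname \<Rightarrow> nexp \<Rightarrow> com \<Rightarrow> com" where
  "for_loop x e c = Seq (NAssign x [] (NConst 0))
     (While (NLess (NVar x []) e) (Seq c (NAssign x [] (NAdd (NVar x []) (NConst 1)))))"

text \<open>Each round adds the loop test and the increment to the body; the final 2 covers the
  initial assignment and the last test. The invariant is required after the increment, so the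
  postcondition of the body speaks of the updated memory.\<close>

lemma runs_for_loop:
  assumes init: "I 0 (update \<sigma> x [] 0) \<rho>"
    and bound: "\<And>k \<sigma> \<rho>. I k \<sigma> \<rho> \<Longrightarrow> nval \<sigma> e = N"
    and body: "\<And>k \<sigma> \<rho>. I k \<sigma> \<rho> \<Longrightarrow> k < N \<Longrightarrow> \<sigma> x [] = k \<Longrightarrow>
      runs c \<sigma> \<rho> T (\<lambda>\<sigma>' \<rho>'. \<sigma>' x [] = k \<and> I (Suc k) (update \<sigma>' x [] (Suc k)) \<rho>')"
    and exit: "\<And>\<sigma> \<rho>. I N \<sigma> \<rho> \<Longrightarrow> Q \<sigma> \<rho>"
  shows "runs (for_loop x e c) \<sigma> \<rho> (N * (T + 2) + 2) Q"
proof -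
  let ?I = "\<lambda>\<sigma> \<rho>. I (\<sigma> x []) \<sigma> \<rho> \<and> \<sigma> x [] \<le> N"
  have "runs (While (NLess (NVar x []) e) (Seq c (NAssign x [] (NAdd (NVar x []) (NConst 1)))))
      (update \<sigma> x [] 0) \<rho> (N * (T + 1 + 1) + 1) Q"
  proof (rule runs_While[where I = ?I and \<mu> = "\<lambda>\<sigma> \<rho>. N - \<sigma> x []"])
    fix \<sigma> \<rho> assume I: "?I \<sigma> \<rho>" and "bval \<sigma> \<rho> (NLess (NVar x []) e)"
    then have "\<sigma> x [] < N" using bound by fastforce
    then show "runs (Seq c (NAssign x [] (NAdd (NVar x []) (NConst 1)))) \<sigma> \<rho> (T + 1)
        (\<lambda>\<sigma>' \<rho>'. ?I \<sigma>' \<rho>' \<and> N - \<sigma>' x [] < N - \<sigma> x [])"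
      using I by (intro runs_Seq runs_conseq[OF body] runs_NAssign) (auto simp: update_def)
  next
    fix \<sigma> \<rho> assume I: "?I \<sigma> \<rho>" and "\<not> bval \<sigma> \<rho> (NLess (NVar x []) e)"
    then have "\<sigma> x [] = N" using bound by fastforce
    then show "Q \<sigma> \<rho>" using exit I by simp
  qed (use init in \<open>auto simp: update_def\<close>)
  then have "runs (for_loop x e c) \<sigma> \<rho> (1 + (N * (T + 1 + 1) + 1)) Q"
    unfolding for_loop_def by (intro runs_Seq runs_NAssign) simp
  then show ?thesis by (rule runs_time) simp
qed

lemma update_apply: "update \<sigma> x is c y = (if y = x then (\<sigma> x)(is := c) else \<sigma> y)"
  by (simp add: update_def)

section \<open>The program\<close>

abbreviation (input) BOr :: "bexp \<Rightarrow> bexp \<Rightarrow> bexp" where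
  "BOr b c \<equiv> BNot (BAnd (BNot b) (BNot c))"

abbreviation (input) NEq :: "nexp \<Rightarrow> nexp \<Rightarrow> bexp" where
  "NEq a b \<equiv> BAnd (BNot (NLess a b)) (BNot (NLess b a))"

abbreviation (input) scalar :: "vname \<Rightarrow> nexp" where
  "scalar x \<equiv> NVar x []"

abbreviation (input) cell :: "vname \<Rightarrow> nexp \<Rightarrow> nexp" where
  "cell x k \<equiv> NVar x [k]"

abbreviation (input) matrix :: "vname \<Rightarrow> nexp \<Rightarrow> nexp \<Rightarrow> rexp" where
  "matrix x k l \<equiv> RVar x [k, l]"

text \<open>
  Array \<open>s\<close> flags the interested agents, and \<open>e\<close> is 1 if there is one. Holders and bid counts are
  stored in \<open>A\<close>, \<open>d\<close> for the auction with the given valuations and in \<open>B\<close>, \<open>D\<close> for the auction with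
  the 0-1 valuations \<open>w\<close>. As in \<open>A\<close>, houses are shifted by one in the variable \<open>b\<close>, the favourite
  of the bidder, where 0 means that no remaining house has positive value.
\<close>

definition best_com :: "vname \<Rightarrow> vname \<Rightarrow> com" where
  "best_com W D =
     (let i = scalar ''i''; h = scalar ''h''; b = scalar ''b''; g = NSub b (NConst 1) in
      Seq (NAssign ''b'' [] (NConst 0))
       (for_loop ''h'' (scalar ''m'')
         (Cond
           (BAnd (BAnd (BNot (NLess (scalar ''n'') (cell D h))) (RLess (RConst 0) (matrix W i h)))
             (BOr (NEq b (NConst 0))
               (BOr (RLess (matrix W i g) (matrix W i h))
                 (BAnd (BNot (RLess (matrix W i h) (matrix W i g)))
                   (NLess (cell D h) (cell D g))))))
           (NAssign ''b'' [] (NAdd h (NConst 1)))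
           Skip)))"

definition evict_com :: "vname \<Rightarrow> com" where
  "evict_com A =
     for_loop ''j'' (scalar ''n'')
       (Cond (NEq (cell A (scalar ''j'')) (scalar ''b''))
         (NAssign A [scalar ''j''] (NConst 0))
         Skip)"

definition bid_com :: "vname \<Rightarrow> vname \<Rightarrow> com" where
  "bid_com A D =
     (let i = scalar ''i''; g = NSub (scalar ''b'') (NConst 1) in
      Seq (evict_com A)
       (Seq (NAssign D [g] (NAdd (cell D g) (NConst 1)))
         (Cond (NLess (scalar ''n'') (cell D g)) Skip (NAssign A [i] (scalar ''b'')))))"

text \<open>The search for an unassigned agent restarts at 0 after each bid since the evicted agent
  may be anywhere. Setting \<open>i\<close> to \<open>n\<close> leaves the loop after a
  failure.\<close>

definition auction_com :: "vname \<Rightarrow> vname \<Rightarrow> vname \<Rightarrow> com" where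
  "auction_com W A D =
     (let i = scalar ''i''; n = scalar ''n'' in
      Seq (NAssign ''fail'' [] (NConst 0))
       (Seq (NAssign ''i'' [] (NConst 0))
         (While (NLess i n)
           (Cond (BAnd (NLess (NConst 0) (cell ''s'' i)) (NEq (cell A i) (NConst 0)))
             (Seq (best_com W D)
               (Cond (NLess (NConst 0) (scalar ''b''))
                 (Seq (bid_com A D) (NAssign ''i'' [] (NConst 0)))
                 (Seq (NAssign ''fail'' [] (NConst 1)) (NAssign ''i'' [] n))))
             (NAssign ''i'' [] (NAdd i (NConst 1)))))))"

definition interested_com :: com where
  "interested_com =
     for_loop ''i'' (scalar ''n'')
       (for_loop ''h'' (scalar ''m'')
         (Cond (RLess (RConst 0) (matrix ''v'' (scalar ''i'') (scalar ''h'')))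
           (Seq (NAssign ''s'' [scalar ''i''] (NConst 1)) (NAssign ''e'' [] (NConst 1)))
           Skip))"

text \<open>A value exceeds the minimum over the interested agents iff it exceeds the value of one
  of them, so the minimum itself is never computed.\<close>

definition threshold_com :: com where
  "threshold_com =
     (let i = scalar ''i''; h = scalar ''h''; j = scalar ''j'' in
      for_loop ''i'' (scalar ''n'')
       (for_loop ''h'' (scalar ''m'')
         (for_loop ''j'' (scalar ''n'')
           (Cond
             (BAnd (NLess (NConst 0) (cell ''s'' j))
               (RLess (matrix ''v'' j (NSub (cell ''A'' j) (NConst 1))) (matrix ''v'' i h)))
             (RAssign ''w'' [i, h] (RConst 1))
             Skip))))"

text \<open>\<open>found\<close> is initially 0, so reporting non-existence takes no action. In the
  second auction the roles are reversed: its failure certifies that \<open>A\<close> is undominated.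
  Without interested agents it is bypassed, since it would succeed with the empty matching.\<close>

definition main_com :: com where
  "main_com =
     Seq interested_com
      (Seq (auction_com ''v'' ''A'' ''d'')
        (Cond (NLess (NConst 0) (scalar ''fail''))
          Skip
          (Cond (NLess (NConst 0) (scalar ''e''))
            (Seq threshold_com
              (Seq (auction_com ''w'' ''B'' ''D'')
                (Cond (NLess (NConst 0) (scalar ''fail''))
                  (NAssign ''found'' [] (NConst 1))
                  Skip)))
            (NAssign ''found'' [] (NConst 1)))))"

section \<open>Correctness and running time of the subprograms\<close>

definition same :: "vname set \<Rightarrow> nat_mem \<Rightarrow> nat_mem \<Rightarrow> bool" where
  "same X \<sigma> \<sigma>' \<longleftrightarrow> (\<forall>x. x \<notin> X \<longrightarrow> \<sigma>' x = \<sigma> x)"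

text \<open>With \<open>k\<close> in place of \<open>m\<close>, \<open>best_bid\<close> concerns
  only the first \<open>k\<close> houses, which makes it the invariant of the search loop.\<close>

definition scan :: "nat \<Rightarrow> nat \<Rightarrow> (nat \<Rightarrow> nat \<Rightarrow> real) \<Rightarrow> (nat \<Rightarrow> nat) \<Rightarrow> nat \<Rightarrow> nat \<Rightarrow> bool" where
  "scan n k w d i b \<longleftrightarrow>
     (case b of 0 \<Rightarrow> \<forall>h. alive n k d h \<longrightarrow> \<not> 0 < w i h | Suc g \<Rightarrow> best_bid n k w d i g)"

lemma alive_Suc: "alive n (Suc k) d h \<longleftrightarrow> alive n k d h \<or> h = k \<and> d h \<le> n"
  by (auto simp: alive_def)

text \<open>The last disjunct demands only that \<open>w i k\<close> is not smaller, instead of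
  equality; a larger value is accepted anyway by the disjunct before it. For \<open>b = 0\<close>
  the index \<open>b - 1\<close> is meaningless, but then the first disjunct holds.\<close>

lemma scan_step:
  assumes scan: "scan n k w d i b"
  shows "\<not> n < d k \<and> 0 < w i k \<and>
      (b = 0 \<or> w i (b - 1) < w i k \<or> \<not> w i k < w i (b - 1) \<and> d k < d (b - 1)) \<Longrightarrow>
      scan n (Suc k) w d i (Suc k)" (is "?better \<Longrightarrow> _")
    and "\<not> (\<not> n < d k \<and> 0 < w i k \<and>
      (b = 0 \<or> w i (b - 1) < w i k \<or> \<not> w i k < w i (b - 1) \<and> d k < d (b - 1))) \<Longrightarrow>
      scan n (Suc k) w d i b"
proof -
  show "scan n (Suc k) w d i (Suc k)" if better: ?better
  proof (cases b)
    case 0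
    then have "w i h \<le> 0" if "alive n k d h" for h
      using scan that by (auto simp: scan_def not_less)
    then show ?thesis
      using better unfolding scan_def best_bid_def alive_Suc by fastforce
  next
    case (Suc g)
    then have g: "w i h < w i g \<or> w i h = w i g \<and> d g \<le> d h" if "alive n k d h" for h
      using scan that by (auto simp: scan_def best_bid_def)
    have "w i h < w i k \<or> w i h = w i k \<and> d k \<le> d h" if "alive n k d h" for h
      using g[OF that] better Suc by auto
    then show ?thesis
      using better unfolding scan_def by (auto simp: best_bid_def alive_Suc)
  qed
  show "scan n (Suc k) w d i b" if "\<not> ?better"
    using scan that unfolding scan_def
    by (cases b) (auto simp: best_bid_def alive_Suc)
qed

lemma runs_best_com:
  fixes \<sigma> :: nat_mem and \<rho> :: real_mem and W D :: vname
  assumes D: "D \<notin> {''b'', ''h''}" and nm: "\<sigma> ''n'' [] = n" "\<sigma> ''m'' [] = m" "\<sigma> ''i'' [] = i"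
  shows "runs (best_com W D) \<sigma> \<rho> (5 * m + 3) (\<lambda>\<sigma>' \<rho>'. \<rho>' = \<rho> \<and> same {''b'', ''h''} \<sigma> \<sigma>' \<and>
      scan n m (\<lambda>i h. \<rho> W [i, h]) (\<lambda>h. \<sigma> D [h]) i (\<sigma>' ''b'' []))"
proof -
  define I where "I k \<sigma>' \<rho>' \<longleftrightarrow> \<rho>' = \<rho> \<and> same {''b'', ''h''} \<sigma> \<sigma>' \<and>
      scan n k (\<lambda>i h. \<rho> W [i, h]) (\<lambda>h. \<sigma> D [h]) i (\<sigma>' ''b'' [])"
    for k \<sigma>' \<rho>'
  show ?thesis
    unfolding best_com_def Let_def
    apply (rule runs_time)
     apply (rule runs_Seq)
     apply (rule runs_NAssign)
     apply (rule runs_for_loop[where I = I and N = m])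
        apply (simp add: I_def update_apply same_def scan_def alive_def)
    using D nm
       apply (simp add: I_def same_def)
      apply (rule runs_Cond)
       apply (rule runs_NAssign)
    subgoal for k \<sigma>' \<rho>'
      using D nm scan_step(1)[of n k "\<lambda>i h. \<rho> W [i, h]" "\<lambda>h. \<sigma> D [h]" i "\<sigma>' ''b'' []"]
      by (auto simp: I_def update_apply same_def)
      apply (rule runs_Skip)
    subgoal for k \<sigma>' \<rho>'
      using D nm scan_step(2)[of n k "\<lambda>i h. \<rho> W [i, h]" "\<lambda>h. \<sigma> D [h]" i "\<sigma>' ''b'' []"]
      by (simp add: I_def update_apply same_def)
     apply (simp add: I_def)
    apply simp
    done
qed

lemma runs_evict_com:
  fixes \<sigma> :: nat_mem and \<rho> :: real_mem and A :: vname
  assumes A: "A \<notin> {''n'', ''b'', ''j''}" and n: "\<sigma> ''n'' [] = n"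
  shows "runs (evict_com A) \<sigma> \<rho> (5 * n + 2) (\<lambda>\<sigma>' \<rho>'. \<rho>' = \<rho> \<and> same {''j'', A} \<sigma> \<sigma>' \<and>
      (\<forall>j. \<sigma>' A [j] = (if j < n \<and> \<sigma> A [j] = \<sigma> ''b'' [] then 0 else \<sigma> A [j])))"
proof -
  define I where "I k \<sigma>' \<rho>' \<longleftrightarrow> \<rho>' = \<rho> \<and> same {''j'', A} \<sigma> \<sigma>' \<and>
      (\<forall>j. \<sigma>' A [j] = (if j < k \<and> \<sigma> A [j] = \<sigma> ''b'' [] then 0 else \<sigma> A [j]))"
    for k \<sigma>' \<rho>'
  have A': "''n'' \<noteq> A" "''b'' \<noteq> A" "''j'' \<noteq> A" using A by auto
  show ?thesis
    unfolding evict_com_def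
    apply (rule runs_time)
     apply (rule runs_for_loop[where I = I and N = n])
    using A A'
        apply (simp add: I_def update_apply same_def)
    using A A' n
       apply (simp add: I_def same_def)
      apply (rule runs_Cond)
       apply (rule runs_NAssign)
    subgoal for k \<sigma>' \<rho>'
      using A A' by (auto simp: I_def update_apply same_def less_Suc_eq)
      apply (rule runs_Skip)
    subgoal for k \<sigma>' \<rho>'
      using A A' by (auto simp: I_def update_apply same_def less_Suc_eq)
     apply (simp add: I_def)
    apply simp
    done
qed

text \<open>The program compares the label with \<open>n\<close> after the increment, so the house
  is withheld iff the old label was at least \<open>n\<close>, as in \<open>bid\<close>. The
  condition on holders reflects that the eviction loop visits only agents below
  \<open>n\<close>.\<close>

lemma runs_bid_com:
  fixes \<sigma> :: nat_mem and \<rho> :: real_mem and A D :: vname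
  assumes A: "A \<notin> {''n'', ''b'', ''j'', ''i'', D}" and D: "D \<notin> {''n'', ''b'', ''j'', ''i''}"
    and n: "\<sigma> ''n'' [] = n" "\<sigma> ''i'' [] = i" "\<sigma> ''b'' [] = Suc g"
    and holder: "\<And>j. \<sigma> A [j] = Suc g \<Longrightarrow> j < n"
  shows "runs (bid_com A D) \<sigma> \<rho> (5 * n + 6) (\<lambda>\<sigma>' \<rho>'. \<rho>' = \<rho> \<and> same {''j'', A, D} \<sigma> \<sigma>' \<and>
      (\<lambda>h. \<sigma>' D [h]) = (\<lambda>h. \<sigma> D [h])(g := Suc (\<sigma> D [g])) \<and>
      (\<lambda>j. \<sigma>' A [j]) = bid n (\<lambda>h. \<sigma> D [h]) i g (\<lambda>j. \<sigma> A [j]))"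
proof -
  have A': "''n'' \<noteq> A" "''b'' \<noteq> A" "''i'' \<noteq> A" "D \<noteq> A"
    and D': "''n'' \<noteq> D" "''b'' \<noteq> D" "''i'' \<noteq> D"
    using A D by auto
  show ?thesis
    unfolding bid_com_def Let_def
    apply (rule runs_time)
     apply (rule runs_Seq)
     apply (rule runs_conseq[OF runs_evict_com[where n = n]])
    using A apply simp
    using n apply simp
     apply (rule runs_Seq)
     apply (rule runs_NAssign)
     apply (rule runs_Cond)
      apply (rule runs_Skip)
    subgoal for \<sigma>' \<rho>'
      using A D A' D' n holder by (auto simp: update_apply same_def bid_def fun_eq_iff)
     apply (rule runs_NAssign)
    subgoal for \<sigma>' \<rho>'
      using A D A' D' n holder by (auto simp: update_apply same_def bid_def fun_eq_iff)
    apply simp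
    done
qed

definition auction_outcome ::
  "nat set \<Rightarrow> nat \<Rightarrow> (nat \<Rightarrow> nat \<Rightarrow> real) \<Rightarrow> (nat \<Rightarrow> nat) \<Rightarrow> nat \<Rightarrow> bool" where
  "auction_outcome S m w a fail \<longleftrightarrow>
     (if fail = 0 then (\<forall>i. a i = 0 \<longleftrightarrow> i \<notin> S) \<and> ef_matching S {..<m} w (\<lambda>i. a i - 1) \<and>
        (\<forall>B. ef_matching S {..<m} w B \<longrightarrow> (\<forall>i\<in>S. w i (B i) \<le> w i (a i - 1)))
      else \<forall>B. \<not> ef_matching S {..<m} w B)"

lemma runs_auction_com:
  fixes \<sigma> :: nat_mem and \<rho> :: real_mem and W A D :: vname
  assumes A: "A \<notin> {''n'', ''m'', ''i'', ''h'', ''b'', ''j'', ''s'', ''fail'', D}"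
    and D: "D \<notin> {''n'', ''m'', ''i'', ''h'', ''b'', ''j'', ''s'', ''fail''}"
    and n: "\<sigma> ''n'' [] = n" "\<sigma> ''m'' [] = m"
    and A0: "\<And>i. \<sigma> A [i] = 0" and D0: "\<And>h. \<sigma> D [h] = 0"
    and S: "S = {i. i < n \<and> 0 < \<sigma> ''s'' [i]}"
  shows "runs (auction_com W A D) \<sigma> \<rho>
      ((m * (n + 1) * (n + 1) + n) * (5 * m + 5 * n + 17) + 3) (\<lambda>\<sigma>' \<rho>'. \<rho>' = \<rho> \<and>
        same {A, D, ''i'', ''h'', ''b'', ''j'', ''fail''} \<sigma> \<sigma>' \<and>
        auction_outcome S m (\<lambda>i h. \<rho> W [i, h]) (\<lambda>i. \<sigma>' A [i]) (\<sigma>' ''fail'' []))"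
proof -
  let ?w = "\<lambda>i h. \<rho> W [i, h]"
  let ?X = "{A, D, ''i'', ''h'', ''b'', ''j'', ''fail''}"
  have A': "''n'' \<noteq> A" "''m'' \<noteq> A" "''i'' \<noteq> A" "''s'' \<noteq> A" "''fail'' \<noteq> A" "D \<noteq> A"
    and D': "''n'' \<noteq> D" "''m'' \<noteq> D" "''i'' \<noteq> D" "''s'' \<noteq> D" "''fail'' \<noteq> D"
    using A D by auto
  have Sn: "S \<subseteq> {..<n}" using S by auto
  define bids where "bids \<sigma>' = (\<Sum>h<m. \<sigma>' D [h])" for \<sigma>' :: nat_mem
  \<comment> \<open>A lexicographic measure: remaining bids, then agents still to be scanned. Labels
    are at most \<open>n + 1\<close>, which bounds the bids by \<open>m * (n + 1)\<close>; the
    weight \<open>n + 1\<close> outweighs the reset of \<open>i\<close> after a bid.\<close>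
  define \<mu> where "\<mu> \<sigma>' (\<rho>' :: real_mem) = (m * (n + 1) - bids \<sigma>') * (n + 1) + (n - \<sigma>' ''i'' [])"
    for \<sigma>' \<rho>'
  \<comment> \<open>In the failure disjunct \<open>i\<close> equals \<open>n\<close>, so the loop
    test is false and the body only ever meets \<open>fail = 0\<close>.\<close>
  define I where "I \<sigma>' \<rho>' \<longleftrightarrow> \<rho>' = \<rho> \<and> same ?X \<sigma> \<sigma>' \<and>
      auction_inv S n m ?w (\<lambda>h. \<sigma>' D [h]) (\<lambda>i. \<sigma>' A [i]) \<and>
      (\<sigma>' ''fail'' [] = 0 \<and> (\<forall>i\<in>S. i < \<sigma>' ''i'' [] \<longrightarrow> \<sigma>' A [i] \<noteq> 0) \<or>
       \<sigma>' ''fail'' [] = 1 \<and> \<sigma>' ''i'' [] = n \<and> (\<forall>B. \<not> ef_matching S {..<m} ?w B))"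
    for \<sigma>' \<rho>'
  have bids_le: "bids \<sigma>' \<le> m * (n + 1)" if "I \<sigma>' \<rho>'" for \<sigma>' \<rho>'
  proof -
    have "\<sigma>' D [h] \<le> n + 1" if "h < m" for h
      using auction_invD(8) \<open>I \<sigma>' \<rho>'\<close> that unfolding I_def by fastforce
    then have "bids \<sigma>' \<le> (\<Sum>h<m. n + 1)"
      unfolding bids_def by (intro sum_mono) auto
    then show ?thesis by simp
  qed
  have bids_Suc: "bids \<sigma>'' = Suc (bids \<sigma>')"
    if "(\<lambda>h. \<sigma>'' D [h]) = (\<lambda>h. \<sigma>' D [h])(g := Suc (\<sigma>' D [g]))" "g < m" for \<sigma>' \<sigma>'' g
  proof -
    have "bids \<sigma>'' = (\<Sum>h<m. \<sigma>' D [h] + (if h = g then 1 else 0))"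
      unfolding bids_def using that(1) by (intro sum.cong) (auto simp: fun_eq_iff)
    also have "\<dots> = Suc (bids \<sigma>')"
      using that(2) by (simp add: sum.distrib bids_def)
    finally show ?thesis .
  qed
  have loop: "runs (While (NLess (scalar ''i'') (scalar ''n''))
          (Cond (BAnd (NLess (NConst 0) (cell ''s'' (scalar ''i''))) (NEq (cell A (scalar ''i'')) (NConst 0)))
             (Seq (best_com W D)
               (Cond (NLess (NConst 0) (scalar ''b''))
                 (Seq (bid_com A D) (NAssign ''i'' [] (NConst 0)))
                 (Seq (NAssign ''fail'' [] (NConst 1)) (NAssign ''i'' [] (scalar ''n'')))))
             (NAssign ''i'' [] (NAdd (scalar ''i'') (NConst 1)))))
         \<sigma>' \<rho>' ((m * (n + 1) * (n + 1) + n) * ((5 * m + 3 + (5 * n + 6 + 1 + (1 + 1) + 1) + 1 + 1) + 1) + 1)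
       (\<lambda>\<sigma>' \<rho>'. \<rho>' = \<rho> \<and> same ?X \<sigma> \<sigma>' \<and>
        auction_outcome S m ?w (\<lambda>i. \<sigma>' A [i]) (\<sigma>' ''fail'' []))"
    if init: "I \<sigma>' \<rho>'" for \<sigma>' \<rho>'
  proof (rule runs_While[where I = I and \<mu> = \<mu>])
    show "I \<sigma>' \<rho>'" by fact
    show "\<mu> \<sigma>' \<rho>' \<le> m * (n + 1) * (n + 1) + n"
      unfolding \<mu>_def by (intro add_mono mult_right_mono) auto
  next
    fix \<sigma>' \<rho>' assume I: "I \<sigma>' \<rho>'" and "\<not> bval \<sigma>' \<rho>' (NLess (scalar ''i'') (scalar ''n''))"
    moreover have "\<sigma>' ''n'' [] = n"
      using I A D A' D' n by (simp add: I_def same_def)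
    ultimately have i: "n \<le> \<sigma>' ''i'' []" by simp
    have inv: "auction_inv S n m ?w (\<lambda>h. \<sigma>' D [h]) (\<lambda>i. \<sigma>' A [i])"
      using I by (simp add: I_def)
    have "auction_outcome S m ?w (\<lambda>i. \<sigma>' A [i]) (\<sigma>' ''fail'' [])"
    proof (cases "\<sigma>' ''fail'' [] = 0")
      case True
      then have all: "\<forall>i\<in>S. \<sigma>' A [i] \<noteq> 0"
        using I i Sn by (fastforce simp: I_def)
      show ?thesis
        using True all auction_result[OF inv all] by (auto simp: auction_outcome_def)
    next
      case False
      then show ?thesis using I by (auto simp: I_def auction_outcome_def)
    qed
    then show "\<rho>' = \<rho> \<and> same ?X \<sigma> \<sigma>' \<and>
        auction_outcome S m ?w (\<lambda>i. \<sigma>' A [i]) (\<sigma>' ''fail'' [])"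
      using I by (simp add: I_def)
  next
    fix \<sigma>' \<rho>' assume I: "I \<sigma>' \<rho>'" and "bval \<sigma>' \<rho>' (NLess (scalar ''i'') (scalar ''n''))"
    moreover have vars: "\<sigma>' ''n'' [] = n" "\<sigma>' ''m'' [] = m" "\<sigma>' ''s'' = \<sigma> ''s''"
      using I A D A' D' n by (auto simp: I_def same_def)
    ultimately have i: "\<sigma>' ''i'' [] < n" by simp
    let ?i = "\<sigma>' ''i'' []"
    let ?d = "\<lambda>h. \<sigma>' D [h]" and ?a = "\<lambda>i. \<sigma>' A [i]"
    have \<rho>': "\<rho>' = \<rho>" and inv: "auction_inv S n m ?w ?d ?a" and "\<sigma>' ''fail'' [] = 0"
      using I i by (auto simp: I_def)
    have holder: "j < n" if "?a j = Suc g" for j g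
      using auction_invD(1)[OF inv that] Sn by auto
    let ?Q = "\<lambda>\<sigma>'' \<rho>''. I \<sigma>'' \<rho>'' \<and> \<mu> \<sigma>'' \<rho>'' < \<mu> \<sigma>' \<rho>'"
    show "runs (Cond (BAnd (NLess (NConst 0) (cell ''s'' (scalar ''i''))) (NEq (cell A (scalar ''i'')) (NConst 0)))
             (Seq (best_com W D)
               (Cond (NLess (NConst 0) (scalar ''b''))
                 (Seq (bid_com A D) (NAssign ''i'' [] (NConst 0)))
                 (Seq (NAssign ''fail'' [] (NConst 1)) (NAssign ''i'' [] (scalar ''n'')))))
             (NAssign ''i'' [] (NAdd (scalar ''i'') (NConst 1))))
         \<sigma>' \<rho>' (5 * m + 3 + (5 * n + 6 + 1 + (1 + 1) + 1) + 1 + 1) ?Q"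
    proof (rule runs_Cond)
      assume "\<not> bval \<sigma>' \<rho>' (BAnd (NLess (NConst 0) (cell ''s'' (scalar ''i'')))
        (NEq (cell A (scalar ''i'')) (NConst 0)))"
      then have *: "?i \<in> S \<longrightarrow> ?a ?i \<noteq> 0"
        using vars S by auto
      show "runs (NAssign ''i'' [] (NAdd (scalar ''i'') (NConst 1))) \<sigma>' \<rho>' 1 ?Q"
        apply (rule runs_NAssign)
        using I i * A D A' D' by (auto simp: I_def \<mu>_def bids_def update_apply same_def less_Suc_eq)
    next
      assume "bval \<sigma>' \<rho>' (BAnd (NLess (NConst 0) (cell ''s'' (scalar ''i'')))
        (NEq (cell A (scalar ''i'')) (NConst 0)))"
      then have iS: "?i \<in> S" and ai: "?a ?i = 0"
        using vars S i by auto
      show "runs (Seq (best_com W D)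
               (Cond (NLess (NConst 0) (scalar ''b''))
                 (Seq (bid_com A D) (NAssign ''i'' [] (NConst 0)))
                 (Seq (NAssign ''fail'' [] (NConst 1)) (NAssign ''i'' [] (scalar ''n'')))))
          \<sigma>' \<rho>' (5 * m + 3 + (5 * n + 6 + 1 + (1 + 1) + 1)) ?Q"
      proof (rule runs_Seq, rule runs_conseq[OF runs_best_com[where \<sigma> = \<sigma>' and i = ?i, OF _ vars(1,2) refl]])
        show "D \<notin> {''b'', ''h''}" using D by simp
        fix \<sigma>2 \<rho>2 assume 2: "\<rho>2 = \<rho>' \<and> same {''b'', ''h''} \<sigma>' \<sigma>2 \<and>
          scan n m (\<lambda>i h. \<rho>' W [i, h]) ?d ?i (\<sigma>2 ''b'' [])"
        then have AD2: "\<sigma>2 A = \<sigma>' A" "\<sigma>2 D = \<sigma>' D" "\<sigma>2 ''n'' [] = n" "\<sigma>2 ''i'' [] = ?i"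
          "\<sigma>2 ''fail'' [] = 0"
          using A D A' D' vars(1) \<open>\<sigma>' ''fail'' [] = 0\<close> by (auto simp: same_def)
        have same2: "same ?X \<sigma> \<sigma>2"
          using 2 I by (auto simp: I_def same_def)
        show "runs (Cond (NLess (NConst 0) (scalar ''b''))
                 (Seq (bid_com A D) (NAssign ''i'' [] (NConst 0)))
                 (Seq (NAssign ''fail'' [] (NConst 1)) (NAssign ''i'' [] (scalar ''n''))))
             \<sigma>2 \<rho>2 (5 * n + 6 + 1 + (1 + 1) + 1) ?Q"
        proof (rule runs_Cond)
          assume "\<not> bval \<sigma>2 \<rho>2 (NLess (NConst 0) (scalar ''b''))"
          then have "\<forall>h. alive n m ?d h \<longrightarrow> \<not> 0 < ?w ?i h"
            using 2 \<rho>' by (simp add: scan_def)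
          then have none: "\<not> ef_matching S {..<m} ?w B" for B
            using auction_stuck[OF inv iS] by simp
          show "runs (Seq (NAssign ''fail'' [] (NConst 1)) (NAssign ''i'' [] (scalar ''n'')))
              \<sigma>2 \<rho>2 (1 + 1) ?Q"
            apply (intro runs_Seq runs_NAssign)
            using 2 same2 inv none i A D A' D' \<rho>' AD2
            by (auto simp: I_def \<mu>_def bids_def update_apply same_def)
        next
          assume "bval \<sigma>2 \<rho>2 (NLess (NConst 0) (scalar ''b''))"
          then obtain g where b: "\<sigma>2 ''b'' [] = Suc g"
            using gr0_implies_Suc by auto
          then have g: "best_bid n m ?w ?d ?i g"
            using 2 \<rho>' by (simp add: scan_def)
          show "runs (Seq (bid_com A D) (NAssign ''i'' [] (NConst 0))) \<sigma>2 \<rho>2 (5 * n + 6 + 1) ?Q"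
          proof (rule runs_Seq, rule runs_conseq[OF runs_bid_com[where \<sigma> = \<sigma>2 and i = ?i and g = g, OF _ _ AD2(3,4) b]])
            show "A \<notin> {''n'', ''b'', ''j'', ''i'', D}" "D \<notin> {''n'', ''b'', ''j'', ''i''}"
              using A D by auto
            show "j < n" if "\<sigma>2 A [j] = Suc g" for j
              using holder that AD2 by simp
            fix \<sigma>3 \<rho>3 assume 3: "\<rho>3 = \<rho>2 \<and> same {''j'', A, D} \<sigma>2 \<sigma>3 \<and>
              (\<lambda>h. \<sigma>3 D [h]) = (\<lambda>h. \<sigma>2 D [h])(g := Suc (\<sigma>2 D [g])) \<and>
              (\<lambda>j. \<sigma>3 A [j]) = bid n (\<lambda>h. \<sigma>2 D [h]) ?i g (\<lambda>j. \<sigma>2 A [j])"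
            let ?\<sigma> = "update \<sigma>3 ''i'' [] 0"
            have upd: "?\<sigma> A = \<sigma>3 A" "?\<sigma> D = \<sigma>3 D" "?\<sigma> ''i'' [] = 0" "?\<sigma> ''fail'' [] = 0"
              using A D A' D' 3 AD2(5) by (auto simp: update_apply same_def)
            have same3: "same ?X \<sigma> ?\<sigma>"
              using 3 same2 by (auto simp: same_def update_apply)
            have "auction_inv S n m ?w (\<lambda>h. \<sigma>3 D [h]) (\<lambda>j. \<sigma>3 A [j])"
              using auction_inv_bid[OF inv Sn iS ai g] 3 AD2 by simp
            then have I3: "I ?\<sigma> \<rho>"
              unfolding I_def using same3 upd by simp
            have "g < m" using g by (simp add: best_bid_def alive_def)
            then have "bids ?\<sigma> = Suc (bids \<sigma>')"
              using 3 AD2 upd by (intro bids_Suc) auto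
            \<comment> \<open>The new state satisfies the invariant, so its bids are still at most
              \<open>m * (n + 1)\<close> and the subtraction is not truncated.\<close>
            then have "m * (n + 1) - bids \<sigma>' = Suc (m * (n + 1) - bids ?\<sigma>)"
              using bids_le[OF I3] by simp
            then have "\<mu> ?\<sigma> \<rho> < \<mu> \<sigma>' \<rho>'"
              using i upd by (simp add: \<mu>_def)
            with I3 show "runs (NAssign ''i'' [] (NConst 0)) \<sigma>3 \<rho>3 1 ?Q"
              using 2 3 \<rho>' by (intro runs_NAssign) simp
          qed
        qed
      qed
    qed
  qed
  let ?\<sigma> = "update (update \<sigma> ''fail'' [] 0) ''i'' [] 0"
  have "(\<lambda>h. ?\<sigma> D [h]) = (\<lambda>_. 0)" "(\<lambda>i. ?\<sigma> A [i]) = (\<lambda>_. 0)"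
    using A D A' D' A0 D0 by (auto simp: update_apply)
  then have "I ?\<sigma> \<rho>"
    unfolding I_def using auction_inv_init by (auto simp: same_def update_apply)
  note loop = loop[OF this]
  show ?thesis
    unfolding auction_com_def Let_def
    apply (rule runs_time)
     apply (rule runs_Seq, rule runs_NAssign)
     apply (rule runs_Seq, rule runs_NAssign)
    using loop apply simp
    apply (simp add: algebra_simps)
    done
qed

lemma lessThan_Suc_Times: "{..<Suc k} \<times> Y = {k} \<times> Y \<union> {..<k} \<times> Y"
  by auto

lemma runs_interested_com:
  fixes \<sigma> :: nat_mem and \<rho> :: real_mem
  assumes n: "\<sigma> ''n'' [] = n" "\<sigma> ''m'' [] = m"
    and init: "\<And>i. \<sigma> ''s'' [i] = 0" "\<sigma> ''e'' [] = 0"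
  shows "runs interested_com \<sigma> \<rho> (n * (6 * m + 4) + 2) (\<lambda>\<sigma>' \<rho>'. \<rho>' = \<rho> \<and>
      same {''i'', ''h'', ''s'', ''e''} \<sigma> \<sigma>' \<and>
      (\<forall>i. \<sigma>' ''s'' [i] = of_bool (i < n \<and> (\<exists>h<m. 0 < \<rho> ''v'' [i, h]))) \<and>
      \<sigma>' ''e'' [] = of_bool (\<exists>i<n. \<exists>h<m. 0 < \<rho> ''v'' [i, h]))"
proof -
  \<comment> \<open>Indexed by the set of visited pairs, one invariant serves both loops: the inner
    one adds a partial row to whatever the outer one has collected.\<close>
  define J where "J P \<sigma>' \<rho>' \<longleftrightarrow> \<rho>' = \<rho> \<and> same {''i'', ''h'', ''s'', ''e''} \<sigma> \<sigma>' \<and>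
      (\<forall>i. \<sigma>' ''s'' [i] = of_bool (\<exists>h. (i, h) \<in> P \<and> 0 < \<rho> ''v'' [i, h])) \<and>
      \<sigma>' ''e'' [] = of_bool (\<exists>(i, h) \<in> P. 0 < \<rho> ''v'' [i, h])" for P \<sigma>' \<rho>'
  have "J {} \<sigma> \<rho>"
    using init by (simp add: J_def same_def)
  have J_update: "J P (update \<sigma>' x [] k) \<rho>' \<longleftrightarrow> J P \<sigma>' \<rho>'" if "x \<in> {''i'', ''h''}" for P \<sigma>' \<rho>' x k
    using that by (auto simp: J_def same_def update_apply)
  have body: "runs (Cond (RLess (RConst 0) (matrix ''v'' (scalar ''i'') (scalar ''h'')))
           (Seq (NAssign ''s'' [scalar ''i''] (NConst 1)) (NAssign ''e'' [] (NConst 1)))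
           Skip) \<sigma>' \<rho>' 4 (\<lambda>\<sigma>'' \<rho>''. J (insert (i, h) P) \<sigma>'' \<rho>'' \<and> \<sigma>'' ''i'' [] = i \<and> \<sigma>'' ''h'' [] = h)"
    if "J P \<sigma>' \<rho>'" "\<sigma>' ''i'' [] = i" "\<sigma>' ''h'' [] = h" for P \<sigma>' \<rho>' i h
    apply (rule runs_time)
     apply (rule runs_Cond)
      apply (rule runs_Seq, rule runs_NAssign, rule runs_NAssign)
    subgoal using that by (auto simp: J_def same_def update_apply)
     apply (rule runs_Skip)
    subgoal using that by (auto simp: J_def same_def update_apply)
    apply simp
    done
  have vars: "\<sigma>' ''n'' [] = n" "\<sigma>' ''m'' [] = m" if "J P \<sigma>' \<rho>'" for P \<sigma>' \<rho>'
    using that n by (auto simp: J_def same_def)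
  have inner: "runs (for_loop ''h'' (scalar ''m'') (Cond (RLess (RConst 0) (matrix ''v'' (scalar ''i'') (scalar ''h'')))
           (Seq (NAssign ''s'' [scalar ''i''] (NConst 1)) (NAssign ''e'' [] (NConst 1)))
           Skip)) \<sigma>' \<rho>' (m * (4 + 2) + 2) (\<lambda>\<sigma>'' \<rho>''. J ({i} \<times> {..<m} \<union> P) \<sigma>'' \<rho>'' \<and> \<sigma>'' ''i'' [] = i)"
    if "J P \<sigma>' \<rho>'" "\<sigma>' ''i'' [] = i" for P \<sigma>' \<rho>' i
    apply (rule runs_for_loop[where I = "\<lambda>h \<sigma>'' \<rho>''. J ({i} \<times> {..<h} \<union> P) \<sigma>'' \<rho>'' \<and> \<sigma>'' ''i'' [] = i"])
    subgoal using that by (simp add: J_update update_apply)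
    subgoal by (auto dest: vars)
    subgoal for h
      by (rule runs_conseq[OF body[of "{i} \<times> {..<h} \<union> P" _ _ i h]])
        (auto simp: J_update update_apply lessThan_Suc)
    subgoal by simp
    done
  have "runs interested_com \<sigma> \<rho> (n * (m * (4 + 2) + 2 + 2) + 2) (\<lambda>\<sigma>' \<rho>'. J ({..<n} \<times> {..<m}) \<sigma>' \<rho>')"
    unfolding interested_com_def
    apply (rule runs_for_loop[where I = "\<lambda>i. J ({..<i} \<times> {..<m})"])
    subgoal using \<open>J {} \<sigma> \<rho>\<close> by (simp add: J_update)
    subgoal by (auto dest: vars)
    subgoal for i
      by (rule runs_conseq[OF inner[of "{..<i} \<times> {..<m}" _ _ i]])
        (auto simp: J_update lessThan_Suc_Times)
    subgoal by simp
    done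
  then have "runs interested_com \<sigma> \<rho> (n * (6 * m + 4) + 2) (\<lambda>\<sigma>' \<rho>'. J ({..<n} \<times> {..<m}) \<sigma>' \<rho>')"
    by (rule runs_time) (simp add: algebra_simps)
  then show ?thesis
    by (rule runs_conseq) (auto simp: J_def)
qed

lemma runs_threshold_com:
  fixes \<sigma> :: nat_mem and \<rho> :: real_mem
  assumes n: "\<sigma> ''n'' [] = n" "\<sigma> ''m'' [] = m"
    and init: "\<And>i h. \<rho> ''w'' [i, h] = 0"
  defines "P \<equiv> \<lambda>i h j. 0 < \<sigma> ''s'' [j] \<and> \<rho> ''v'' [j, \<sigma> ''A'' [j] - 1] < \<rho> ''v'' [i, h]"
  shows "runs threshold_com \<sigma> \<rho> (n * (m * (5 * n + 4) + 4) + 2) (\<lambda>\<sigma>' \<rho>'.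
      same {''i'', ''h'', ''j''} \<sigma> \<sigma>' \<and>
      (\<forall>i<n. \<forall>h<m. \<rho>' ''w'' [i, h] = of_bool (\<exists>j<n. P i h j)))"
proof -
  \<comment> \<open>Since \<open>w\<close> starts at zero and only ones are written, each entry is
    the disjunction over the visited triples.\<close>
  define J where "J X \<sigma>' \<rho>' \<longleftrightarrow> same {''i'', ''h'', ''j''} \<sigma> \<sigma>' \<and> \<rho>' ''v'' = \<rho> ''v'' \<and>
      (\<forall>i h. \<rho>' ''w'' [i, h] = of_bool (\<exists>j. (i, h, j) \<in> X \<and> P i h j))" for X \<sigma>' \<rho>'
  have "J {} \<sigma> \<rho>"
    using init by (simp add: J_def same_def)
  have J_update: "J X (update \<sigma>' x [] k) \<rho>' \<longleftrightarrow> J X \<sigma>' \<rho>'"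
    if "x \<in> {''i'', ''h'', ''j''}" for X \<sigma>' \<rho>' x k
    using that by (auto simp: J_def same_def update_apply)
  let ?c = "Cond
             (BAnd (NLess (NConst 0) (cell ''s'' (scalar ''j'')))
               (RLess (matrix ''v'' (scalar ''j'') (NSub (cell ''A'' (scalar ''j'')) (NConst 1)))
                 (matrix ''v'' (scalar ''i'') (scalar ''h''))))
             (RAssign ''w'' [scalar ''i'', scalar ''h''] (RConst 1))
             Skip"
  have body: "runs ?c \<sigma>' \<rho>' 3 (\<lambda>\<sigma>'' \<rho>''. J (insert (i, h, j) X) \<sigma>'' \<rho>'' \<and>
      \<sigma>'' ''i'' [] = i \<and> \<sigma>'' ''h'' [] = h \<and> \<sigma>'' ''j'' [] = j)"
    if J: "J X \<sigma>' \<rho>'" and vars: "\<sigma>' ''i'' [] = i" "\<sigma>' ''h'' [] = h" "\<sigma>' ''j'' [] = j"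
    for X \<sigma>' \<rho>' i h j
  proof -
    have same: "same {''i'', ''h'', ''j''} \<sigma> \<sigma>'" "\<rho>' ''v'' = \<rho> ''v''"
      and w: "\<rho>' ''w'' [i', h'] = of_bool (\<exists>j'. (i', h', j') \<in> X \<and> P i' h' j')" for i' h'
      using J by (simp_all add: J_def)
    have test: "bval \<sigma>' \<rho>' (BAnd (NLess (NConst 0) (cell ''s'' (scalar ''j'')))
               (RLess (matrix ''v'' (scalar ''j'') (NSub (cell ''A'' (scalar ''j'')) (NConst 1)))
                 (matrix ''v'' (scalar ''i'') (scalar ''h'')))) \<longleftrightarrow> P i h j"
      using same vars by (simp add: P_def same_def)
    have "J (insert (i, h, j) X) \<sigma>' (update \<rho>' ''w'' [i, h] 1)" if P: "P i h j"
      unfolding J_def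
    proof (intro conjI allI)
      fix i' h'
      show "update \<rho>' ''w'' [i, h] 1 ''w'' [i', h'] =
          of_bool (\<exists>j'. (i', h', j') \<in> insert (i, h, j) X \<and> P i' h' j')"
        using P w[of i' h'] by (cases "i' = i \<and> h' = h") (auto simp: update_apply)
    qed (use same in \<open>simp_all add: update_apply\<close>)
    moreover have "J (insert (i, h, j) X) \<sigma>' \<rho>'" if "\<not> P i h j"
    proof -
      have "(i', h', j') \<in> insert (i, h, j) X \<and> P i' h' j' \<longleftrightarrow> (i', h', j') \<in> X \<and> P i' h' j'"
        for i' h' j'
        using that by auto
      then show ?thesis using J unfolding J_def by simp
    qed
    ultimately have "runs ?c \<sigma>' \<rho>' (1 + 1 + 1) (\<lambda>\<sigma>'' \<rho>''. J (insert (i, h, j) X) \<sigma>'' \<rho>'' \<and>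
        \<sigma>'' ''i'' [] = i \<and> \<sigma>'' ''h'' [] = h \<and> \<sigma>'' ''j'' [] = j)"
      using vars by (intro runs_Cond runs_RAssign runs_Skip; subst (asm) test) simp_all
    then show ?thesis by (rule runs_time) simp
  qed
  have vars: "\<sigma>' ''n'' [] = n" "\<sigma>' ''m'' [] = m" if "J X \<sigma>' \<rho>'" for X \<sigma>' \<rho>'
    using that n by (auto simp: J_def same_def)
  have loop_j: "runs (for_loop ''j'' (scalar ''n'') ?c) \<sigma>' \<rho>' (n * (3 + 2) + 2)
      (\<lambda>\<sigma>'' \<rho>''. J ({i} \<times> {h} \<times> {..<n} \<union> X) \<sigma>'' \<rho>'' \<and> \<sigma>'' ''i'' [] = i \<and> \<sigma>'' ''h'' [] = h)"
    if "J X \<sigma>' \<rho>'" "\<sigma>' ''i'' [] = i" "\<sigma>' ''h'' [] = h" for X \<sigma>' \<rho>' i h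
    apply (rule runs_for_loop[where I = "\<lambda>j \<sigma>'' \<rho>''. J ({i} \<times> {h} \<times> {..<j} \<union> X) \<sigma>'' \<rho>'' \<and>
        \<sigma>'' ''i'' [] = i \<and> \<sigma>'' ''h'' [] = h"])
    subgoal using that by (simp add: J_update update_apply)
    subgoal by (auto dest: vars)
    subgoal for j
      by (rule runs_conseq[OF body[of "{i} \<times> {h} \<times> {..<j} \<union> X" _ _ i h j]])
        (auto simp: J_update update_apply lessThan_Suc)
    subgoal by simp
    done
  have loop_h: "runs (for_loop ''h'' (scalar ''m'') (for_loop ''j'' (scalar ''n'') ?c)) \<sigma>' \<rho>'
      (m * (n * (3 + 2) + 2 + 2) + 2)
      (\<lambda>\<sigma>'' \<rho>''. J ({i} \<times> {..<m} \<times> {..<n} \<union> X) \<sigma>'' \<rho>'' \<and> \<sigma>'' ''i'' [] = i)"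
    if "J X \<sigma>' \<rho>'" "\<sigma>' ''i'' [] = i" for X \<sigma>' \<rho>' i
    apply (rule runs_for_loop[where I = "\<lambda>h \<sigma>'' \<rho>''. J ({i} \<times> {..<h} \<times> {..<n} \<union> X) \<sigma>'' \<rho>'' \<and>
        \<sigma>'' ''i'' [] = i"])
    subgoal using that by (simp add: J_update update_apply)
    subgoal by (auto dest: vars)
    subgoal for h
      by (rule runs_conseq[OF loop_j[of "{i} \<times> {..<h} \<times> {..<n} \<union> X" _ _ i h]])
        (auto simp: J_update update_apply lessThan_Suc_Times Sigma_Un_distrib2 Un_assoc)
    subgoal by simp
    done
  have "runs threshold_com \<sigma> \<rho> (n * (m * (n * (3 + 2) + 2 + 2) + 2 + 2) + 2)
      (J ({..<n} \<times> {..<m} \<times> {..<n}))"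
    unfolding threshold_com_def Let_def
    apply (rule runs_for_loop[where I = "\<lambda>i. J ({..<i} \<times> {..<m} \<times> {..<n})"])
    subgoal using \<open>J {} \<sigma> \<rho>\<close> by (simp add: J_update)
    subgoal by (auto dest: vars)
    subgoal for i
      by (rule runs_conseq[OF loop_h[of "{..<i} \<times> {..<m} \<times> {..<n}" _ _ i]])
        (auto simp: J_update lessThan_Suc_Times)
    subgoal by simp
    done
  then have "runs threshold_com \<sigma> \<rho> (n * (m * (5 * n + 4) + 4) + 2) (J ({..<n} \<times> {..<m} \<times> {..<n}))"
    by (rule runs_time) (simp add: algebra_simps)
  then show ?thesis
    by (rule runs_conseq) (auto simp: J_def)
qed

section \<open>The complete program and its polynomial running time\<close>

definition auction_time :: "nat \<Rightarrow> nat \<Rightarrow> nat" where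
  "auction_time n m = (m * (n + 1) * (n + 1) + n) * (5 * m + 5 * n + 17) + 3"

definition main_time :: "nat \<Rightarrow> nat \<Rightarrow> nat" where
  "main_time n m = n * (6 * m + 4) + 2 + (auction_time n m +
     (1 + ((n * (m * (5 * n + 4) + 4) + 2 + (auction_time n m + (1 + 1 + 1))) + 1 + 1) + 1))"

lemma runs_main_com:
  assumes inst: "house_instance {..<n} {..<m} v"
  defines "Good \<equiv> \<lambda>A. allocation {..<n} {..<m} A \<and> envy_free {..<n} v A \<and> egal_max {..<n} {..<m} v A"
  shows "runs main_com (fst (input_state n m v)) (snd (input_state n m v)) (main_time n m)
     (\<lambda>\<sigma>' \<rho>'. if \<exists>A. Good A then output_flag (\<sigma>', \<rho>') = 1 \<and> Good (output_alloc (\<sigma>', \<rho>'))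
       else output_flag (\<sigma>', \<rho>') = 0)" (is "runs _ ?\<sigma> ?\<rho> _ ?Q")
proof -
  let ?H = "{..<m}"
  define S where "S = interested {..<n} ?H v"
  have Sn: "S \<subseteq> {..<n}" by (auto simp: S_def interested_def)
  have zero: "?\<sigma> x (i # is) = 0" for x i "is" by (simp add: input_state_def)
  have zero': "?\<sigma> x [] = 0" if "x \<noteq> ''n''" "x \<noteq> ''m''" for x
    using that by (simp add: input_state_def)
  have nm: "?\<sigma> ''n'' [] = n" "?\<sigma> ''m'' [] = m"
    by (simp_all add: input_state_def)
  have v: "?\<rho> ''v'' [i, h] = v i h" if "i < n" "h < m" for i h
    using that by (simp add: input_state_def)
  have w0: "?\<rho> ''w'' [i, h] = 0" for i h
    by (simp add: input_state_def)
  \<comment> \<open>The input matrix agrees with \<open>v\<close> only for agents below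
    \<open>n\<close> and houses below \<open>m\<close>, which is all that matchings of
    \<open>S\<close> into \<open>?H\<close> depend on.\<close>
  have ef_cong: "ef_matching S ?H (\<lambda>i h. ?\<rho> ''v'' [i, h]) B \<longleftrightarrow> ef_matching S ?H v B" for B
    using Sn v by (intro ef_matching_cong) auto
  show ?thesis
    unfolding main_com_def main_time_def
  proof (rule runs_Seq, rule runs_conseq[OF runs_interested_com[where \<sigma> = ?\<sigma>, OF nm]], goal_cases)
    case (3 \<sigma>1 \<rho>1)
    then have \<rho>1: "\<rho>1 = ?\<rho>" and same1: "same {''i'', ''h'', ''s'', ''e''} ?\<sigma> \<sigma>1"
      and s1: "\<sigma>1 ''s'' [i] = of_bool (i < n \<and> (\<exists>h<m. 0 < ?\<rho> ''v'' [i, h]))"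
      and e1: "\<sigma>1 ''e'' [] = of_bool (\<exists>i<n. \<exists>h<m. 0 < ?\<rho> ''v'' [i, h])" for i
      by auto
    have S1: "S = {i. i < n \<and> 0 < \<sigma>1 ''s'' [i]}"
      by (auto simp: s1 v S_def interested_def cong: conj_cong)
    have e1: "0 < \<sigma>1 ''e'' [] \<longleftrightarrow> S \<noteq> {}"
      using e1 by (auto simp: v S_def interested_def cong: conj_cong)
    have nm1: "\<sigma>1 ''n'' [] = n" "\<sigma>1 ''m'' [] = m"
      using same1 nm by (auto simp: same_def)
    have zero1: "\<sigma>1 x (i # is) = 0" if "x \<noteq> ''s''" "x \<noteq> ''i''" "x \<noteq> ''h''" "x \<noteq> ''e''" for x i "is"
      using same1 zero that by (simp add: same_def)
    show ?case unfolding \<rho>1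
    proof (rule runs_Seq, unfold auction_time_def,
        rule runs_conseq[OF runs_auction_com[where \<sigma> = \<sigma>1 and A = "''A''" and D = "''d''", OF _ _ nm1 _ _ S1]], goal_cases)
      case (5 \<sigma>2 \<rho>2)
      then have \<rho>2: "\<rho>2 = ?\<rho>" and same2: "same {''A'', ''d'', ''i'', ''h'', ''b'', ''j'', ''fail''} \<sigma>1 \<sigma>2"
        and out2: "auction_outcome S m (\<lambda>i h. ?\<rho> ''v'' [i, h]) (\<lambda>i. \<sigma>2 ''A'' [i]) (\<sigma>2 ''fail'' [])"
        by auto
      let ?a = "\<lambda>i. \<sigma>2 ''A'' [i]"
      let ?b = "\<lambda>i. ?a i - 1"
      have nm2: "\<sigma>2 ''n'' [] = n" "\<sigma>2 ''m'' [] = m" and s2: "\<sigma>2 ''s'' = \<sigma>1 ''s''"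
        and e2: "\<sigma>2 ''e'' = \<sigma>1 ''e''" and found2: "\<sigma>2 ''found'' [] = 0"
        using same2 nm1 same1 zero' by (auto simp: same_def)
      show ?case unfolding \<rho>2
      proof (rule runs_Cond)
        assume "bval \<sigma>2 ?\<rho> (NLess (NConst 0) (scalar ''fail''))"
        then have "\<not> ef_matching S ?H v B" for B
          using out2 ef_cong by (simp add: auction_outcome_def)
        then have "\<not> Good A" for A
          using ef_egal_max_imp_ef_matching[OF inst, of A] unfolding Good_def S_def by blast
        then show "runs Skip \<sigma>2 ?\<rho> 1 ?Q"
          using found2 by (intro runs_Skip) (simp add: output_flag_def)
      next
        assume "\<not> bval \<sigma>2 ?\<rho> (NLess (NConst 0) (scalar ''fail''))"
        then have *: "(\<forall>i. ?a i = 0 \<longleftrightarrow> i \<notin> S) \<and> ef_matching S ?H v ?b \<and>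
            (\<forall>B. ef_matching S ?H v B \<longrightarrow> (\<forall>i\<in>S. ?\<rho> ''v'' [i, B i] \<le> ?\<rho> ''v'' [i, ?b i]))"
          using out2 ef_cong by (simp add: auction_outcome_def)
        then have a: "?a i = 0 \<longleftrightarrow> i \<notin> S" and b: "ef_matching S ?H v ?b" for i
          by auto
        have opt: "v i (B i) \<le> v i (?b i)" if B: "ef_matching S ?H v B" and i: "i \<in> S" for i B
        proof -
          have "B i < m" "?b i < m" "i < n"
            using B b i Sn by (auto simp: ef_matching_def)
          moreover have "?\<rho> ''v'' [i, B i] \<le> ?\<rho> ''v'' [i, ?b i]"
            using * B i by blast
          ultimately show ?thesis by (simp add: v)
        qed
        \<comment> \<open>Only the array \<open>A\<close> of the final state matters, so this serves
          both successful ends of the program.\<close>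
        have good: "Good (output_alloc (\<sigma>', \<rho>'))"
          if "S = {} \<or> \<not> dominated S ?H v ?b" "\<sigma>' ''A'' = \<sigma>2 ''A''" for \<sigma>' \<rho>'
        proof -
          have "output_alloc (\<sigma>', \<rho>') = alloc_of S ?b"
          proof
            fix i
            show "output_alloc (\<sigma>', \<rho>') i = alloc_of S ?b i"
              using a[of i] that(2)
              by (cases "i \<in> S") (auto simp: output_alloc_def alloc_of_def split: nat.splits)
          qed
          then show ?thesis
            using ef_matching_imp_ef_egal_max[OF inst, of ?b] b that(1)
            unfolding Good_def S_def by simp
        qed
        show "runs (Cond (NLess (NConst 0) (scalar ''e''))
            (Seq threshold_com
              (Seq (auction_com ''w'' ''B'' ''D'')
                (Cond (NLess (NConst 0) (scalar ''fail''))
                  (NAssign ''found'' [] (NConst 1))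
                  Skip)))
            (NAssign ''found'' [] (NConst 1))) \<sigma>2 ?\<rho>
          ((n * (m * (5 * n + 4) + 4) + 2 +
            ((m * (n + 1) * (n + 1) + n) * (5 * m + 5 * n + 17) + 3 + (1 + 1 + 1))) + 1 + 1) ?Q"
        proof (rule runs_Cond)
          assume "\<not> bval \<sigma>2 ?\<rho> (NLess (NConst 0) (scalar ''e''))"
          then have "S = {}" using e1 e2 by simp
          then have "Good (output_alloc (update \<sigma>2 ''found'' [] 1, ?\<rho>))"
            by (intro good) (auto simp: update_apply)
          then show "runs (NAssign ''found'' [] (NConst 1)) \<sigma>2 ?\<rho> 1 ?Q"
            by (intro runs_NAssign) (auto simp: output_flag_def update_apply)
        next
          assume "bval \<sigma>2 ?\<rho> (NLess (NConst 0) (scalar ''e''))"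
          then have ne: "S \<noteq> {}" using e1 e2 by simp
          let ?thr = "\<lambda>i h. of_bool (\<exists>j\<in>S. v j (?b j) < v i h) :: real"
          show "runs (Seq threshold_com
              (Seq (auction_com ''w'' ''B'' ''D'')
                (Cond (NLess (NConst 0) (scalar ''fail''))
                  (NAssign ''found'' [] (NConst 1))
                  Skip))) \<sigma>2 ?\<rho>
            (n * (m * (5 * n + 4) + 4) + 2 +
              ((m * (n + 1) * (n + 1) + n) * (5 * m + 5 * n + 17) + 3 + (1 + 1 + 1))) ?Q"
          proof (rule runs_Seq, rule runs_conseq[OF
                runs_threshold_com[where \<sigma> = \<sigma>2 and \<rho> = ?\<rho>, OF nm2 w0]])
            fix \<sigma>3 :: nat_mem and \<rho>3 :: real_mem
            assume 3: "same {''i'', ''h'', ''j''} \<sigma>2 \<sigma>3 \<and> (\<forall>i<n. \<forall>h<m. \<rho>3 ''w'' [i, h] =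
              of_bool (\<exists>j<n. 0 < \<sigma>2 ''s'' [j] \<and> ?\<rho> ''v'' [j, \<sigma>2 ''A'' [j] - 1] < ?\<rho> ''v'' [i, h]))"
            have bm: "?b j < m" if "j \<in> S" for j
              using b that by (auto simp: ef_matching_def)
            have w3: "\<rho>3 ''w'' [i, h] = ?thr i h" if "i < n" "h < m" for i h
            proof -
              have "(\<exists>j<n. 0 < \<sigma>2 ''s'' [j] \<and> ?\<rho> ''v'' [j, ?b j] < ?\<rho> ''v'' [i, h]) \<longleftrightarrow>
                (\<exists>j\<in>S. ?\<rho> ''v'' [j, ?b j] < v i h)"
                using S1 s2 v[OF that] by auto
              also have "\<dots> \<longleftrightarrow> (\<exists>j\<in>S. v j (?b j) < v i h)"
                using v bm Sn by (intro bex_cong) auto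
              finally show ?thesis using 3 that by simp
            qed
            have thr: "ef_matching S ?H (\<lambda>i h. \<rho>3 ''w'' [i, h]) B \<longleftrightarrow> ef_matching S ?H ?thr B" for B
              using Sn by (intro ef_matching_cong w3) auto
            have nm3: "\<sigma>3 ''n'' [] = n" "\<sigma>3 ''m'' [] = m" and A3: "\<sigma>3 ''A'' = \<sigma>2 ''A''"
              and found3: "\<sigma>3 ''found'' [] = 0"
              and S3: "S = {i. i < n \<and> 0 < \<sigma>3 ''s'' [i]}"
              using 3 nm2 S1 s2 found2 by (auto simp: same_def)
            show "runs (Seq (auction_com ''w'' ''B'' ''D'')
                (Cond (NLess (NConst 0) (scalar ''fail''))
                  (NAssign ''found'' [] (NConst 1))
                  Skip)) \<sigma>3 \<rho>3
              ((m * (n + 1) * (n + 1) + n) * (5 * m + 5 * n + 17) + 3 + (1 + 1 + 1)) ?Q"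
            proof (rule runs_Seq, rule runs_conseq[OF runs_auction_com[where \<sigma> = \<sigma>3
                  and A = "''B''" and D = "''D''", OF _ _ nm3 _ _ S3]], goal_cases)
              case (5 \<sigma>4 \<rho>4)
              \<comment> \<open>Through the 0-1 valuations, failure of the second auction is the
                absence of a dominating matching.\<close>
              then have A4: "\<sigma>4 ''A'' = \<sigma>2 ''A''" and found4: "\<sigma>4 ''found'' [] = 0"
                and out4: "0 < \<sigma>4 ''fail'' [] \<longleftrightarrow> \<not> dominated S ?H v ?b"
                using A3 found3 unfolding dominated_iff_ef_matching auction_outcome_def thr
                by (auto simp: same_def split: if_splits)
              show ?case
              proof (rule runs_Cond)
                assume "bval \<sigma>4 \<rho>4 (NLess (NConst 0) (scalar ''fail''))"
                then have "Good (output_alloc (update \<sigma>4 ''found'' [] 1, \<rho>4))"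
                  using out4 A4 by (intro good) (auto simp: update_apply)
                then show "runs (NAssign ''found'' [] (NConst 1)) \<sigma>4 \<rho>4 1 ?Q"
                  by (intro runs_NAssign) (auto simp: output_flag_def update_apply)
              next
                assume "\<not> bval \<sigma>4 \<rho>4 (NLess (NConst 0) (scalar ''fail''))"
                then have "dominated S ?H v ?b" using out4 by simp
                then have "\<not> Good A" for A
                  using no_ef_egal_max_if_dominated[OF inst, of ?b A] opt ne
                  unfolding Good_def S_def by blast
                then show "runs Skip \<sigma>4 \<rho>4 1 ?Q"
                  using found4 by (intro runs_Skip) (simp add: output_flag_def)
              qed
            qed (use 3 zero1 same2 in \<open>auto simp: same_def\<close>)
          qed
        qed
      qed
    qed (use zero1 in auto)
  qed (use zero zero' in auto)
qed

text \<open>Evaluating all bounds at the one argument \<open>n + m\<close> makes closure under sums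
  and products immediate from \<open>poly_add\<close> and \<open>poly_mult\<close>.\<close>

definition poly_bounded :: "(nat \<Rightarrow> nat \<Rightarrow> nat) \<Rightarrow> bool" where
  "poly_bounded f \<longleftrightarrow> (\<exists>p. \<forall>n m. f n m \<le> poly p (n + m))"

lemma poly_bounded_const: "poly_bounded (\<lambda>n m. c)"
  unfolding poly_bounded_def by (rule exI[of _ "[:c:]"]) simp

lemma poly_bounded_agents: "poly_bounded (\<lambda>n m. n)"
  and poly_bounded_houses: "poly_bounded (\<lambda>n m. m)"
  unfolding poly_bounded_def by (rule exI[of _ "[:0, 1:]"]; simp)+

lemma poly_bounded_add:
  assumes "poly_bounded f" "poly_bounded g"
  shows "poly_bounded (\<lambda>n m. f n m + g n m)"
  using assms unfolding poly_bounded_def by (metis poly_add add_mono)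

lemma poly_bounded_mult:
  assumes "poly_bounded f" "poly_bounded g"
  shows "poly_bounded (\<lambda>n m. f n m * g n m)"
  using assms unfolding poly_bounded_def by (metis poly_mult mult_le_mono)

lemma poly_bounded_main_time: "poly_bounded main_time"
  unfolding main_time_def[abs_def] auction_time_def
  by (intro poly_bounded_add poly_bounded_mult poly_bounded_agents poly_bounded_houses
      poly_bounded_const)

theorem theorem5p2:
  shows "\<exists>(prog :: com) (p :: nat poly).
    \<forall>(n :: nat) (m :: nat) (v :: nat \<Rightarrow> nat \<Rightarrow> real).
      house_instance {..<n} {..<m} v \<longrightarrow>
      (\<exists>t s. exec prog (input_state n m v) t s \<and> t \<le> poly p (n + m) \<and>
        (if \<exists>A. allocation {..<n} {..<m} A \<and> envy_free {..<n} v A \<and> egal_max {..<n} {..<m} v A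
         then output_flag s = 1 \<and>
              allocation {..<n} {..<m} (output_alloc s) \<and>
              envy_free {..<n} v (output_alloc s) \<and>
              egal_max {..<n} {..<m} v (output_alloc s)
         else output_flag s = 0))"
proof -
  obtain p where p: "main_time n m \<le> poly p (n + m)" for n m
    using poly_bounded_main_time unfolding poly_bounded_def by blast
  show ?thesis
  proof (intro exI[of _ main_com] exI[of _ p] allI impI)
    fix n m and v :: "nat \<Rightarrow> nat \<Rightarrow> real"
    assume "house_instance {..<n} {..<m} v"
    from runs_time[OF runs_main_com[OF this] p]
    show "\<exists>t s. exec main_com (input_state n m v) t s \<and> t \<le> poly p (n + m) \<and>
        (if \<exists>A. allocation {..<n} {..<m} A \<and> envy_free {..<n} v A \<and> egal_max {..<n} {..<m} v A
         then output_flag s = 1 \<and>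
              allocation {..<n} {..<m} (output_alloc s) \<and>
              envy_free {..<n} v (output_alloc s) \<and>
              egal_max {..<n} {..<m} v (output_alloc s)
         else output_flag s = 0)"
      unfolding runs_def prod.collapse by blast
  qed
qed
end
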